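(* Let $\{X_n\}_{n\ge 0}$ be a two-type branching process with immigration (with the notation fixed in the context) such that $f(\mathbf 0)=\mathbf 0$, the mean matrix $M$ is positively regular, and its maximal eigenvalue satisfies $\rho>1$. Let $$Y_n=\rho^{-n}\Big(\boldsymbol u\cdot X_n-\frac{\rho^{n+1}-1}{\rho-1}(\boldsymbol u\cdot\boldsymbol\lambda)\Big),\qquad n\ge0,$$ and let $Y$ be the almost sure limit of $Y_n$ as $n\to\infty$. Assume that $E_i\big(e^{\theta_0(\mathbf 1\cdot X_1)}\big)<\infty$ for some $\theta_0>0$ and $i=1,2$. Then there are constants $0<C_4<\infty$ and $0<\kappa_1<\infty$ such that for all $\varepsilon>0$, $i=1,2$ and all $n\ge1$, $$P_i(|Y_n-Y|>\varepsilon)\le C_4\,e^{-\kappa_1\varepsilon^{2/3}(\rho^{1/3})^n}.$$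
   Context: $\mathbb N=\{0,1,2,\dots\}$, $\mathbf 1=(1,1)$, $\mathbf 0=(0,0)$, $e_1=(1,0)$, $e_2=(0,1)$; vectors are row vectors and $\cdot$ is the Euclidean inner product. $\{Z_n\}_{n\ge0}$, $Z_n=(Z_n^{(1)},Z_n^{(2)})$, is a two-type Galton–Watson branching process: each particle of type $i$ independently produces, in the next generation, a random vector of offspring with law $P_i(j_1,j_2)=P(Z_1=(j_1,j_2)\mid Z_0=e_i)$. Its offspring generating functions are $f^{(i)}(\boldsymbol s)=\sum_{\boldsymbol j\in\mathbb N^2}P_i(j_1,j_2)s_1^{j_1}s_2^{j_2}$, $i=1,2$, $\boldsymbol s\in[0,1]^2$, and $f=(f^{(1)},f^{(2)})$. $I_1,I_2,\dots$ are i.i.d. $\mathbb N^2$-valued immigration vectors, independent of the reproduction, with mean $\boldsymbol\lambda=E(I_1)=(\lambda_1,\lambda_2)$. The process with immigration is $X_0=Z_0$, $X_n=Z_n+U_n^{(1)}+\cdots+U_n^{(n)}$ for $n\ge1$, where $U_n^{(k)}$ is the vector of numbers of descendants, in generation $n$, of the $k$-th immigration $I_k$ (so $U_n^{(n)}=I_n$); all particles reproduce independently with the same offspring laws. Equivalently, given $X_n=\boldsymbol j$, $X_{n+1}$ is the sum of the offspring vectors of the $j_1$ particles of type 1 and the $j_2$ particles of type 2 plus the independent vector $I_{n+1}$. $P_i$ and $E_i$ denote probability and expectation given $X_0=e_i$. $M=(m_{ij})$ with $m_{ij}=\partial f^{(i)}/\partial s_j(\mathbf 1^-)$ is the mean matrix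 (with finite entries). Positively regular means that some power of $M$ has all entries strictly positive; $\rho$ is then the maximal (Perron–Frobenius) eigenvalue of $M$, with strictly positive left eigenvector $\boldsymbol v$ and right eigenvector $\boldsymbol u$ normalized by $\boldsymbol v\cdot\boldsymbol u=1$, $\boldsymbol u\cdot\mathbf 1=1$. The sequence $(Y_n)$ is a martingale that converges almost surely, so $Y$ is well defined. *)

theory Defs
  imports "HOL-Probability.Probability"
begin

text \<open>
  Types of particles are the elements of the two-element type 2, and the population vectors are
  elements of \<^typ>\<open>nat ^ 2\<close>.  The unit vector of a type \<open>i\<close> is \<open>axis i 1\<close>.
\<close>

definition rvec :: "nat ^ 'n \<Rightarrow> real ^ 'n" where
  "rvec x = (\<chi> i. real (x $ i))"

subsection \<open>Generating functions and the mean matrix\<close>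

definition offspring_gf :: "('n \<Rightarrow> (nat ^ 'n) pmf) \<Rightarrow> real ^ 'n \<Rightarrow> real ^ ('n::finite)" where
  "offspring_gf off s = (\<chi> i. \<Sum>\<^sub>\<infinity>x\<in>UNIV. pmf (off i) x * (\<Prod>t\<in>UNIV. s $ t ^ (x $ t)))"

text \<open>
  The entries are the left partial derivatives, at the point \<open>(1, \<dots>, 1)\<close>, of the generating
  functions; the existence of a real derivative includes the finiteness of the means.
\<close>

definition is_mean_matrix :: "('n \<Rightarrow> (nat ^ 'n) pmf) \<Rightarrow> real ^ 'n ^ ('n::finite) \<Rightarrow> bool" where
  "is_mean_matrix off m \<longleftrightarrow>
     (\<forall>i j. ((\<lambda>s. offspring_gf off (\<chi> t. if t = j then s else 1) $ i)
              has_real_derivative m $ i $ j) (at_left 1))"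

text \<open>
  Powers with respect to the matrix product \<open>**\<close>; the library power on \<^typ>\<open>real ^ 'n ^ 'n\<close>
  is taken entrywise.
\<close>

primrec matrix_power :: "real ^ 'n ^ 'n \<Rightarrow> nat \<Rightarrow> real ^ 'n ^ ('n::finite)" where
  "matrix_power m 0 = mat 1"
| "matrix_power m (Suc k) = m ** matrix_power m k"

definition positively_regular :: "real ^ 'n ^ ('n::finite) \<Rightarrow> bool" where
  "positively_regular m \<longleftrightarrow> (\<exists>k\<ge>1. \<forall>i j. matrix_power m k $ i $ j > 0)"

text \<open>A real eigenvalue that is maximal in modulus among all complex eigenvalues.\<close>

definition is_max_eigenvalue :: "real ^ 'n ^ ('n::finite) \<Rightarrow> real \<Rightarrow> bool" where
  "is_max_eigenvalue m r \<longleftrightarrow>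
     (\<exists>w. w \<noteq> 0 \<and> m *v w = r *s w) \<and>
     (\<forall>z w. w \<noteq> 0 \<and> map_matrix complex_of_real m *v w = z *s w \<longrightarrow> cmod z \<le> r)"

subsection \<open>The branching process with immigration\<close>

text \<open>
  \<open>xi t l\<close> is the offspring vector of the \<open>l\<close>-th particle (counted from 0) of type \<open>t\<close> of the
  current generation.
\<close>

definition reproduce :: "('n \<Rightarrow> nat \<Rightarrow> nat ^ 'n) \<Rightarrow> nat ^ 'n \<Rightarrow> nat ^ ('n::finite)" where
  "reproduce xi z = (\<Sum>t\<in>UNIV. \<Sum>l<z $ t. xi t l)"

text \<open>
  The population, \<open>m\<close> generations later, descending from the particles \<open>z\<close> living in
  generation \<open>k\<close>; \<open>xi n\<close> collects the offspring vectors of the particles of generation \<open>n\<close>.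
\<close>

primrec descendants ::
  "(nat \<Rightarrow> 'n \<Rightarrow> nat \<Rightarrow> nat ^ 'n) \<Rightarrow> nat \<Rightarrow> nat ^ 'n \<Rightarrow> nat \<Rightarrow> nat ^ ('n::finite)" where
  "descendants xi k z 0 = z"
| "descendants xi k z (Suc m) = reproduce (xi (k + m)) (descendants xi k z m)"

text \<open>
  \<open>xi k n t l\<close> is the offspring vector of the \<open>l\<close>-th particle of type \<open>t\<close> among the particles
  of generation \<open>n\<close> that descend from the \<open>k\<close>-th immigration, where \<open>k = 0\<close> stands for
  the initial population \<open>Z\<^sub>0\<close>.
\<close>

definition bpi ::
  "(nat \<Rightarrow> nat \<Rightarrow> 'n \<Rightarrow> nat \<Rightarrow> 'w \<Rightarrow> nat ^ 'n) \<Rightarrow> (nat \<Rightarrow> 'w \<Rightarrow> nat ^ 'n) \<Rightarrow> ('w \<Rightarrow> nat ^ 'n)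
     \<Rightarrow> nat \<Rightarrow> 'w \<Rightarrow> nat ^ ('n::finite)" where
  "bpi xi I Z0 n \<omega> =
     descendants (\<lambda>r t l. xi 0 r t l \<omega>) 0 (Z0 \<omega>) n +
     (\<Sum>k=1..n. descendants (\<lambda>r t l. xi k r t l \<omega>) k (I k \<omega>) (n - k))"

text \<open>
  Under the probability measure \<open>P\<close> the process starts from a single particle of type \<open>i\<close>, and
  the offspring vectors and the immigration vectors \<open>I 1, I 2, \<dots>\<close> (\<open>I 0\<close> is not used) are all
  mutually independent with the prescribed laws.
\<close>

locale bpi_driver = prob_space P
  for P :: "'w measure"
    and i :: "'n::finite"
    and off :: "'n \<Rightarrow> (nat ^ 'n) pmf"
    and imm :: "(nat ^ 'n) pmf"
    and xi :: "nat \<Rightarrow> nat \<Rightarrow> 'n \<Rightarrow> nat \<Rightarrow> 'w \<Rightarrow> nat ^ 'n"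
    and I :: "nat \<Rightarrow> 'w \<Rightarrow> nat ^ 'n"
    and Z0 :: "'w \<Rightarrow> nat ^ 'n" +
  assumes Z0_measurable: "Z0 \<in> measurable P (count_space UNIV)"
    and Z0_start: "AE \<omega> in P. Z0 \<omega> = axis i 1"
    and xi_law: "distr P (count_space UNIV) (xi k n t l) = measure_pmf (off t)"
    and I_law: "k \<ge> 1 \<Longrightarrow> distr P (count_space UNIV) (I k) = measure_pmf imm"
    and independent:
      "indep_vars (\<lambda>_. count_space UNIV) (case_sum (\<lambda>(k, n, t, l). xi k n t l) I)
         (UNIV <+> {1..})"

text \<open>The centred and normalised process, with \<open>lam\<close> the mean immigration vector.\<close>

definition Y_seq ::
  "real \<Rightarrow> real ^ 'n \<Rightarrow> real ^ 'n \<Rightarrow> (nat \<Rightarrow> 'w \<Rightarrow> nat ^ 'n) \<Rightarrow> nat \<Rightarrow> 'w \<Rightarrow> real" where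
  "Y_seq \<rho> u lam X n \<omega> =
     inverse (\<rho> ^ n) * (u \<bullet> rvec (X n \<omega>) - (\<rho> ^ (n + 1) - 1) / (\<rho> - 1) * (u \<bullet> lam))"

end

theory Submission
  imports Defs
begin

text \<open>
  Write \<open>L x = u \<bullet> x\<close>. Exponential moments and \<open>M u = \<rho> u\<close> bound the conditional Laplace
  transform of a generation by
  \<open>E (exp (a L X\<^sub>n\<^sub>+\<^sub>1) | X\<^sub>n) \<le> exp ((\<rho> a + c a\<^sup>2) L X\<^sub>n + a (u \<bullet> \<lambda>) + c a\<^sup>2)\<close> for all
  small \<open>a\<close> of either sign. Iterating this backwards from generation \<open>m\<close> to \<open>n\<close>, with the
  exponents controlled by the supersolution \<open>x + \<beta> x\<^sup>2\<close> at \<open>x = \<tau> / \<rho>\<^sup>k\<close>, shows that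
  \<open>E exp (\<tau> (Y\<^sub>m - Y\<^sub>n))\<close> is at most a constant times \<open>E exp (\<beta> \<tau>\<^sup>2 \<rho>\<^sup>-\<^sup>2\<^sup>n L X\<^sub>n)\<close>, and, starting
  from generation 0, that the latter is bounded when \<open>\<tau>\<^sup>2 \<le> \<eta>\<^sup>2 \<rho>\<^sup>n\<close>. Taking
  \<open>\<tau> = \<plusminus>\<eta> \<rho>\<^sup>n\<^sup>/\<^sup>2\<close>, Fatou's lemma (\<open>m \<rightarrow> \<infinity>\<close>) and Markov's inequality give the bound
  \<open>C exp (- \<eta> \<epsilon> \<rho>\<^sup>n\<^sup>/\<^sup>2)\<close>, which implies the claim since \<open>x\<^sup>2\<^sup>/\<^sup>3 \<le> 1 + x\<close>.
\<close>

section \<open>Measurability in countable discrete spaces\<close>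

lemma measurable_add_count_space:
  fixes f g :: "'a \<Rightarrow> 'b::{countable, plus}"
  assumes f: "f \<in> measurable N (count_space UNIV)" and g: "g \<in> measurable N (count_space UNIV)"
  shows "(\<lambda>w. f w + g w) \<in> measurable N (count_space UNIV)"
proof (rule measurable_compose_countable[OF _ f])
  fix x :: 'b
  show "(\<lambda>w. x + g w) \<in> measurable N (count_space UNIV)"
    by (rule measurable_compose[OF g]) simp
qed

lemma measurable_sum_count_space:
  fixes f :: "'i \<Rightarrow> 'a \<Rightarrow> 'b::{countable, comm_monoid_add}"
  assumes "\<And>i. i \<in> A \<Longrightarrow> f i \<in> measurable N (count_space UNIV)"
  shows "(\<lambda>w. \<Sum>i\<in>A. f i w) \<in> measurable N (count_space UNIV)"
  using assms
  by (induction A rule: infinite_finite_induct) (auto intro: measurable_add_count_space)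

text \<open>The number of summands is random; fixing each of the countably many values of
  \<open>z\<close> leaves a finite sum.\<close>

lemma measurable_reproduce:
  fixes x :: "'n::finite \<Rightarrow> nat \<Rightarrow> 'a \<Rightarrow> nat ^ 'n"
  assumes x: "\<And>t l. x t l \<in> measurable N (count_space UNIV)"
    and z: "z \<in> measurable N (count_space UNIV)"
  shows "(\<lambda>w. reproduce (\<lambda>t l. x t l w) (z w)) \<in> measurable N (count_space UNIV)"
proof (rule measurable_compose_countable[OF _ z])
  fix y :: "nat ^ 'n"
  show "(\<lambda>w. reproduce (\<lambda>t l. x t l w) y) \<in> measurable N (count_space UNIV)"
    unfolding reproduce_def by (intro measurable_sum_count_space x)
qed

section \<open>Population vectors, lineages and the process\<close>

lemma rvec_add: "rvec (x + y) = rvec x + rvec y"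
  by (simp add: rvec_def vec_eq_iff)

lemma rvec_sum: "rvec (\<Sum>i\<in>A. f i) = (\<Sum>i\<in>A. rvec (f i))"
  by (induction A rule: infinite_finite_induct)
     (auto simp: rvec_add, auto simp: rvec_def vec_eq_iff)

lemma inner_rvec: "u \<bullet> rvec x = (\<Sum>i\<in>UNIV. u $ i * real (x $ i))"
  by (simp add: inner_vec_def rvec_def)

lemma inner_rvec_nonneg: "(\<And>i. 0 \<le> u $ i) \<Longrightarrow> 0 \<le> u \<bullet> rvec x"
  by (simp add: inner_rvec sum_nonneg)

lemma inner_rvec_axis: "u \<bullet> rvec (axis i 1) = u $ i"
proof -
  have "rvec (axis i 1) = axis i 1"
    by (simp add: rvec_def axis_def vec_eq_iff)
  then show ?thesis
    by (simp add: inner_axis)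
qed

lemma inner_rvec_reproduce:
  "u \<bullet> rvec (reproduce x z) = (\<Sum>t\<in>UNIV. \<Sum>l<z $ t. u \<bullet> rvec (x t l))"
  by (simp add: reproduce_def rvec_sum inner_sum_right)

text \<open>
  The part of generation \<open>n\<close> that descends from the \<open>k\<close>-th immigration, for \<open>k \<le> n\<close>
  (the subtraction is truncated otherwise); \<open>k = 0\<close> is the initial population.
\<close>

definition lineage ::
  "(nat \<Rightarrow> nat \<Rightarrow> 'n \<Rightarrow> nat \<Rightarrow> 'w \<Rightarrow> nat ^ 'n) \<Rightarrow> (nat \<Rightarrow> 'w \<Rightarrow> nat ^ 'n) \<Rightarrow> ('w \<Rightarrow> nat ^ 'n)
     \<Rightarrow> nat \<Rightarrow> nat \<Rightarrow> 'w \<Rightarrow> nat ^ ('n::finite)" where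
  "lineage xi I Z0 k n w =
     descendants (\<lambda>r t l. xi k r t l w) k (if k = 0 then Z0 w else I k w) (n - k)"

lemma lineage_self: "lineage xi I Z0 k k w = (if k = 0 then Z0 w else I k w)"
  by (simp add: lineage_def)

lemma lineage_Suc:
  "k \<le> n \<Longrightarrow> lineage xi I Z0 k (Suc n) w = reproduce (\<lambda>t l. xi k n t l w) (lineage xi I Z0 k n w)"
  by (simp add: lineage_def Suc_diff_le)

lemma bpi_eq_sum_lineage: "bpi xi I Z0 n w = (\<Sum>k\<le>n. lineage xi I Z0 k n w)"
proof -
  have "(\<Sum>k\<le>n. lineage xi I Z0 k n w) = lineage xi I Z0 0 n w + (\<Sum>k=1..n. lineage xi I Z0 k n w)"
    by (simp add: sum.atMost_shift sum.atLeast1_atMost_eq)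
  also have "(\<Sum>k=1..n. lineage xi I Z0 k n w)
      = (\<Sum>k=1..n. descendants (\<lambda>r t l. xi k r t l w) k (I k w) (n - k))"
    by (intro sum.cong) (auto simp: lineage_def)
  finally show ?thesis
    by (simp add: bpi_def lineage_def)
qed

lemma bpi_Suc:
  "bpi xi I Z0 (Suc n) w =
     (\<Sum>k\<le>n. reproduce (\<lambda>t l. xi k n t l w) (lineage xi I Z0 k n w)) + I (Suc n) w"
  by (simp add: bpi_eq_sum_lineage lineage_Suc lineage_self)

text \<open>Needed to recompute a lineage on another sample space, from the coordinates of past
  driving variables alone.\<close>

lemma lineage_cong:
  assumes "k \<le> n" "Z0 w = Z0' w'"
    and "\<And>r t l. r < n \<Longrightarrow> xi k r t l w = xi' k r t l w'"
    and "1 \<le> k \<Longrightarrow> I k w = I' k w'"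
  shows "lineage xi I Z0 k n w = lineage xi' I' Z0' k n w'"
  using assms by (induction n rule: dec_induct) (auto simp: lineage_self lineage_Suc)

lemma measurable_lineage:
  assumes "k \<le> n" and "Z0 \<in> measurable N (count_space UNIV)"
    and "\<And>r t l. r < n \<Longrightarrow> xi k r t l \<in> measurable N (count_space UNIV)"
    and "1 \<le> k \<Longrightarrow> I k \<in> measurable N (count_space UNIV)"
  shows "lineage xi I Z0 k n \<in> measurable N (count_space UNIV)"
  using assms
proof (induction n rule: dec_induct)
  case base
  have "lineage xi I Z0 k k = (if k = 0 then Z0 else I k)"
    by (simp add: fun_eq_iff lineage_self)
  with base show ?case
    by simp
next
  case (step n)
  then have "(\<lambda>w. reproduce (\<lambda>t l. xi k n t l w) (lineage xi I Z0 k n w)) \<in> measurable N (count_space UNIV)"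
    by (intro measurable_reproduce) auto
  also have "(\<lambda>w. reproduce (\<lambda>t l. xi k n t l w) (lineage xi I Z0 k n w)) = lineage xi I Z0 k (Suc n)"
    using step.hyps by (simp add: fun_eq_iff lineage_Suc)
  finally show ?case .
qed

lemma measurable_bpi:
  assumes "Z0 \<in> measurable N (count_space UNIV)"
    and "\<And>k r t l. k \<le> n \<Longrightarrow> r < n \<Longrightarrow> xi k r t l \<in> measurable N (count_space UNIV)"
    and "\<And>k. 1 \<le> k \<Longrightarrow> k \<le> n \<Longrightarrow> I k \<in> measurable N (count_space UNIV)"
  shows "bpi xi I Z0 n \<in> measurable N (count_space UNIV)"
  unfolding bpi_eq_sum_lineage[abs_def]
  using assms by (intro measurable_sum_count_space measurable_lineage) auto

section \<open>Fubini for independent variables and quadratic bounds of Laplace transforms\<close>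

text \<open>The joint law is the product of the marginals, so Fubini applies. This takes the place
  of conditional expectations.\<close>

lemma (in prob_space) nn_integral_indep_var:
  assumes AB: "indep_var S A T B" and F[measurable]: "F \<in> borel_measurable (S \<Otimes>\<^sub>M T)"
  shows "(\<integral>\<^sup>+w. F (A w, B w) \<partial>M) = (\<integral>\<^sup>+w. (\<integral>\<^sup>+w'. F (A w, B w') \<partial>M) \<partial>M)"
proof -
  have A[measurable]: "random_variable S A" and B[measurable]: "random_variable T B"
    and eq: "distr M S A \<Otimes>\<^sub>M distr M T B = distr M (S \<Otimes>\<^sub>M T) (\<lambda>w. (A w, B w))"
    using AB unfolding indep_var_distribution_eq by auto
  interpret B: prob_space "distr M T B"
    by (rule prob_space_distr) (rule B)
  have F': "F \<in> borel_measurable (distr M S A \<Otimes>\<^sub>M distr M T B)"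
    by measurable
  have "(\<integral>\<^sup>+w. F (A w, B w) \<partial>M) = (\<integral>\<^sup>+p. F p \<partial>(distr M S A \<Otimes>\<^sub>M distr M T B))"
    unfolding eq by (subst nn_integral_distr) auto
  also have "\<dots> = (\<integral>\<^sup>+a. (\<integral>\<^sup>+b. F (a, b) \<partial>distr M T B) \<partial>distr M S A)"
    by (rule B.nn_integral_fst[OF F', symmetric])
  also have "\<dots> = (\<integral>\<^sup>+w. (\<integral>\<^sup>+b. F (A w, b) \<partial>distr M T B) \<partial>M)"
    by (subst nn_integral_distr) auto
  also have "\<dots> = (\<integral>\<^sup>+w. (\<integral>\<^sup>+w'. F (A w, B w') \<partial>M) \<partial>M)"
  proof (rule nn_integral_cong)
    fix w assume "w \<in> space M"
    then have "A w \<in> space S"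
      by (rule measurable_space[OF A])
    then show "(\<integral>\<^sup>+b. F (A w, b) \<partial>distr M T B) = (\<integral>\<^sup>+w'. F (A w, B w') \<partial>M)"
      by (intro nn_integral_distr) measurable
  qed
  finally show ?thesis .
qed

text \<open>Taylor's formula with Lagrange remainder; the absolute value in the remainder covers
  both signs of \<open>y\<close>.\<close>

lemma exp_le_quadratic: "exp y \<le> 1 + y + y\<^sup>2 / 2 * exp \<bar>y\<bar>" for y :: real
proof -
  obtain t where "\<bar>t\<bar> \<le> \<bar>y\<bar>" "exp y = (\<Sum>m<2. y ^ m / fact m) + exp t / fact 2 * y ^ 2"
    using Maclaurin_exp_le by blast
  moreover from this have "exp t / 2 * y\<^sup>2 \<le> exp \<bar>y\<bar> / 2 * y\<^sup>2"
    by (intro mult_right_mono divide_right_mono) auto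
  ultimately show ?thesis
    by (simp add: numeral_2_eq_2 algebra_simps)
qed

text \<open>The Taylor remainder is absorbed by \<open>exp (\<theta> * f x)\<close>: half of the
  exponent dominates \<open>exp \<bar>a * f x\<bar>\<close>, the other half dominates the factor
  \<open>(f x)\<^sup>2\<close>. Finally \<open>1 + y \<le> exp y\<close> restores the exponential
  form, which multiplies well over particles.\<close>

lemma (in prob_space) exp_moment_le_quadratic:
  fixes f :: "'a \<Rightarrow> real"
  assumes th: "\<theta> > 0" and f0: "\<And>x. 0 \<le> f x"
    and f[measurable]: "f \<in> borel_measurable M"
    and int: "integrable M (\<lambda>x. exp (\<theta> * f x))"
  shows "\<exists>c\<ge>0. \<forall>a. \<bar>a\<bar> \<le> \<theta> / 2 \<longrightarrow>
    (\<integral>\<^sup>+x. ennreal (exp (a * f x)) \<partial>M) \<le> ennreal (exp (a * expectation f + c * a\<^sup>2))"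
proof -
  define E where "E = expectation (\<lambda>x. exp (\<theta> * f x))"
  \<comment> \<open>From \<open>z\<^sup>2 / 2 \<le> exp z\<close> at
    \<open>z = \<theta> / 2 * f x\<close> comes the factor \<open>8 / \<theta>\<^sup>2\<close> for
    \<open>(f x)\<^sup>2\<close>; the Taylor remainder halves it.\<close>
  define c where "c = 4 / \<theta>\<^sup>2 * E"
  have E0: "0 \<le> E"
    unfolding E_def by simp
  have c0: "0 \<le> c"
    using E0 by (simp add: c_def)
  have intf: "integrable M f"
  proof (rule Bochner_Integration.integrable_bound[OF integrable_mult_left[OF int, of "1 / \<theta>"]])
    show "AE x in M. norm (f x) \<le> norm (exp (\<theta> * f x) * (1 / \<theta>))"
    proof (rule AE_I2)
      fix x
      have "\<theta> * f x \<le> exp (\<theta> * f x)"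
        using exp_ge_add_one_self[of "\<theta> * f x"] by linarith
      then show "norm (f x) \<le> norm (exp (\<theta> * f x) * (1 / \<theta>))"
        using th f0[of x] by (simp add: field_simps)
    qed
  qed measurable
  have bd: "exp (a * f x) \<le> 1 + a * f x + (4 / \<theta>\<^sup>2 * a\<^sup>2) * exp (\<theta> * f x)" if a: "\<bar>a\<bar> \<le> \<theta> / 2" for a x
  proof -
    let ?z = "\<theta> / 2 * f x"
    have z: "0 \<le> ?z"
      using th f0[of x] by simp
    have "?z\<^sup>2 / 2 \<le> exp ?z"
      using exp_lower_Taylor_quadratic[OF z] z by linarith
    then have sq: "(f x)\<^sup>2 \<le> 8 / \<theta>\<^sup>2 * exp ?z"
      using th by (simp add: field_simps power2_eq_square)
    have "exp (a * f x) \<le> 1 + a * f x + (a * f x)\<^sup>2 / 2 * exp \<bar>a * f x\<bar>"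
      by (rule exp_le_quadratic)
    also have "(a * f x)\<^sup>2 / 2 * exp \<bar>a * f x\<bar> \<le> (a\<^sup>2 * (8 / \<theta>\<^sup>2 * exp ?z)) / 2 * exp ?z"
    proof (intro mult_mono divide_right_mono)
      show "(a * f x)\<^sup>2 \<le> a\<^sup>2 * (8 / \<theta>\<^sup>2 * exp ?z)"
        unfolding power_mult_distrib by (intro mult_left_mono sq) auto
      show "exp \<bar>a * f x\<bar> \<le> exp ?z"
        using mult_right_mono[OF a f0[of x]] f0[of x] by (simp add: abs_mult)
    qed auto
    also have "\<dots> = (4 / \<theta>\<^sup>2 * a\<^sup>2) * (exp ?z * exp ?z)"
      by (simp add: field_simps)
    also have "exp ?z * exp ?z = exp (\<theta> * f x)"
      by (simp flip: exp_add)
    finally show ?thesis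
      by simp
  qed
  show ?thesis
  proof (intro exI[of _ c] conjI c0 allI impI)
    fix a assume a: "\<bar>a\<bar> \<le> \<theta> / 2"
    have iB: "integrable M (\<lambda>x. 1 + a * f x + (4 / \<theta>\<^sup>2 * a\<^sup>2) * exp (\<theta> * f x))"
      by (intro Bochner_Integration.integrable_add integrable_mult_right intf int integrable_const)
    have "(\<integral>\<^sup>+x. ennreal (exp (a * f x)) \<partial>M)
        \<le> (\<integral>\<^sup>+x. ennreal (1 + a * f x + (4 / \<theta>\<^sup>2 * a\<^sup>2) * exp (\<theta> * f x)) \<partial>M)"
      by (intro nn_integral_mono ennreal_leI bd a)
    also have "\<dots> = ennreal (expectation (\<lambda>x. 1 + a * f x + (4 / \<theta>\<^sup>2 * a\<^sup>2) * exp (\<theta> * f x)))"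
      using bd[OF a] by (intro nn_integral_eq_integral iB AE_I2) (meson exp_ge_zero order_trans)
    also have "expectation (\<lambda>x. 1 + a * f x + (4 / \<theta>\<^sup>2 * a\<^sup>2) * exp (\<theta> * f x))
        = 1 + (a * expectation f + c * a\<^sup>2)"
      using intf int by (simp add: c_def E_def prob_space)
    also have "ennreal \<dots> \<le> ennreal (exp (a * expectation f + c * a\<^sup>2))"
      by (intro ennreal_leI exp_ge_add_one_self)
    finally show "(\<integral>\<^sup>+x. ennreal (exp (a * f x)) \<partial>M) \<le> ennreal (exp (a * expectation f + c * a\<^sup>2))" .
  qed
qed

section \<open>Mean matrix and expected offspring\<close>

text \<open>On the unit cube the monomials are bounded by 1, so the series is dominated by the
  summable \<open>pmf\<close> and is an honest expectation.\<close>

lemma offspring_gf_eq_expectation: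
  assumes "\<And>t. 0 \<le> s $ t" "\<And>t. s $ t \<le> 1"
  shows "offspring_gf off s $ i = measure_pmf.expectation (off i) (\<lambda>x. \<Prod>t\<in>UNIV. s $ t ^ (x $ t))"
proof -
  have b: "norm (\<Prod>t\<in>UNIV. s $ t ^ (x $ t)) \<le> 1" for x
    using assms by (auto simp: abs_prod intro!: prod_le_1 power_le_one)
  have "Infinite_Set_Sum.abs_summable_on (\<lambda>x. pmf (off i) x * (\<Prod>t\<in>UNIV. s $ t ^ (x $ t))) UNIV"
    by (rule abs_summable_on_comparison_test[OF pmf_abs_summable[of "off i" UNIV]])
       (use b in \<open>simp add: abs_mult mult_left_le\<close>)
  then show ?thesis
    by (simp add: offspring_gf_def pmf_expectation_eq_infsetsum infsetsum_infsum)
qed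

text \<open>The difference quotient of \<open>s ^ k\<close> at 1 is the geometric sum
  \<open>\<Sum>l<k. s ^ l\<close>, which is at most \<open>k\<close> and tends to \<open>k\<close>
  as \<open>s\<close> tends to 1 from below. Dominated convergence identifies the left derivative
  with the mean.\<close>

lemma mean_matrix_eq_expectation:
  assumes M: "is_mean_matrix off M"
    and int: "integrable (measure_pmf (off i)) (\<lambda>x. real (x $ j))"
  shows "M $ i $ j = measure_pmf.expectation (off i) (\<lambda>x. real (x $ j))"
proof -
  define G where "G s = offspring_gf off (\<chi> t. if t = j then s else 1) $ i" for s
  have G: "G s = measure_pmf.expectation (off i) (\<lambda>x. s ^ (x $ j))" if "0 \<le> s" "s \<le> 1" for s
  proof -
    have "(\<Prod>t\<in>UNIV. (if t = j then s else 1) ^ (x $ t)) = s ^ (x $ j)" for x :: "nat ^ 'a"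
    proof -
      have "(\<Prod>t\<in>UNIV. (if t = j then s else 1) ^ (x $ t)) = (\<Prod>t\<in>UNIV. if t = j then s ^ (x $ j) else 1)"
        by (intro prod.cong) auto
      then show ?thesis
        by simp
    qed
    then show ?thesis
      unfolding G_def using that by (subst offspring_gf_eq_expectation) auto
  qed
  \<comment> \<open>A concrete sequence in \<open>[0, 1)\<close> tending to 1, since dominated
    convergence is applied along sequences.\<close>
  define s where "s n = 1 - inverse (real (Suc n))" for n
  have s0: "0 \<le> s n" "s n < 1" for n
    by (auto simp: s_def field_simps)
  have slim: "s \<longlonglongrightarrow> 1"
    unfolding s_def using tendsto_diff[OF tendsto_const LIMSEQ_inverse_real_of_nat, of 1] by simp
  have "(G has_real_derivative M $ i $ j) (at_left 1)"
    using M unfolding is_mean_matrix_def G_def by simp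
  then have "((\<lambda>y. (G y - G 1) / (y - 1)) \<longlongrightarrow> M $ i $ j) (at_left 1)"
    by (simp add: has_field_derivative_iff)
  moreover have "filterlim s (at_left 1) sequentially"
    unfolding filterlim_at using s0 slim by (auto intro!: always_eventually simp: less_imp_neq)
  ultimately have lim1: "(\<lambda>n. (G (s n) - G 1) / (s n - 1)) \<longlonglongrightarrow> M $ i $ j"
    by (rule filterlim_compose)
  have quot: "(x ^ k - 1) / (x - 1) = (\<Sum>l<k. x ^ l)" if "x < 1" for x :: real and k
    using that power_diff_1_eq[of x k] by (simp add: field_simps)
  have eq: "(G (s n) - G 1) / (s n - 1) = measure_pmf.expectation (off i) (\<lambda>x. \<Sum>l<x $ j. s n ^ l)" for n
  proof -
    have "integrable (measure_pmf (off i)) (\<lambda>x. s n ^ (x $ j))"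
      using s0[of n] by (intro measure_pmf.integrable_const_bound[where B=1]) (auto intro: power_le_one less_imp_le)
    then have "measure_pmf.expectation (off i) (\<lambda>x. (s n ^ (x $ j) - 1) / (s n - 1)) = (G (s n) - G 1) / (s n - 1)"
      using s0[of n] by (simp add: G)
    then show ?thesis
      using s0[of n] by (simp add: quot)
  qed
  have "(\<lambda>n. measure_pmf.expectation (off i) (\<lambda>x. \<Sum>l<x $ j. s n ^ l))
      \<longlonglongrightarrow> measure_pmf.expectation (off i) (\<lambda>x. real (x $ j))"
  proof (rule integral_dominated_convergence[OF _ _ int])
    show "AE x in off i. (\<lambda>n. \<Sum>l<x $ j. s n ^ l) \<longlonglongrightarrow> real (x $ j)"
    proof (rule AE_I2)
      fix x
      have "(\<lambda>n. \<Sum>l<x $ j. s n ^ l) \<longlonglongrightarrow> (\<Sum>l<x $ j. 1 ^ l)"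
        by (intro tendsto_sum tendsto_power slim)
      then show "(\<lambda>n. \<Sum>l<x $ j. s n ^ l) \<longlonglongrightarrow> real (x $ j)"
        by simp
    qed
    show "AE x in off i. norm (\<Sum>l<x $ j. s n ^ l) \<le> real (x $ j)" for n
    proof (rule AE_I2)
      fix x
      have "(\<Sum>l<x $ j. s n ^ l) \<le> (\<Sum>l<x $ j. 1)"
        using s0[of n] by (intro sum_mono power_le_one) (auto intro: less_imp_le)
      moreover have "0 \<le> (\<Sum>l<x $ j. s n ^ l)"
        using s0[of n] by (intro sum_nonneg) auto
      ultimately show "norm (\<Sum>l<x $ j. s n ^ l) \<le> real (x $ j)"
        by simp
    qed
  qed auto
  with lim1 show ?thesis
    unfolding eq by (rule LIMSEQ_unique)
qed

section \<open>One reproduction step\<close>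

context bpi_driver
begin

abbreviation driver :: "(nat \<times> nat \<times> 'n \<times> nat) + nat \<Rightarrow> 'w \<Rightarrow> nat ^ 'n" where
  "driver \<equiv> case_sum (\<lambda>(k, n, t, l). xi k n t l) I"

lemma measurable_xi: "xi k n t l \<in> measurable P (count_space UNIV)"
proof -
  have "random_variable (count_space UNIV) (driver (Inl (k, n, t, l)))"
    using independent unfolding indep_vars_def by blast
  then show ?thesis
    by simp
qed

lemma measurable_I: "1 \<le> k \<Longrightarrow> I k \<in> measurable P (count_space UNIV)"
proof -
  assume "1 \<le> k"
  then have "random_variable (count_space UNIV) (driver (Inr k))"
    using independent unfolding indep_vars_def by blast
  then show ?thesis
    by simp
qed

lemma measurable_bpi_driver:
  "z \<in> measurable P (count_space UNIV) \<Longrightarrow> bpi xi I z n \<in> measurable P (count_space UNIV)"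
  by (intro measurable_bpi measurable_xi measurable_I)

lemma nn_integral_xi: "(\<integral>\<^sup>+w. g (xi k n t l w) \<partial>P) = (\<integral>\<^sup>+x. g x \<partial>off t)"
  by (subst xi_law[of k n t l, symmetric]) (auto simp: nn_integral_distr measurable_xi)

lemma nn_integral_I: "1 \<le> k \<Longrightarrow> (\<integral>\<^sup>+w. g (I k w) \<partial>P) = (\<integral>\<^sup>+x. g x \<partial>imm)"
  by (subst I_law[of k, symmetric]) (auto simp: nn_integral_distr measurable_I)

text \<open>For deterministic current populations \<open>d k\<close>, the next generation is a
  finite sum of independent vectors, so its transform factorizes. A particle of type
  \<open>t\<close> contributes an exponent proportional to \<open>u $ t\<close>; these add up to a
  multiple of \<open>u \<bullet> rvec (d k)\<close> again.\<close>

lemma nn_integral_exp_generation_le: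
  fixes d :: "nat \<Rightarrow> nat ^ 'n"
  assumes off: "\<And>t. (\<integral>\<^sup>+x. ennreal (exp (a * (u \<bullet> rvec x))) \<partial>off t) \<le> ennreal (exp (a' * u $ t))"
    and imm: "(\<integral>\<^sup>+x. ennreal (exp (a * (u \<bullet> rvec x))) \<partial>imm) \<le> ennreal (exp r)"
  shows "(\<integral>\<^sup>+w. ennreal (exp (a * (u \<bullet> rvec
      ((\<Sum>k\<le>m. reproduce (\<lambda>t l. xi k m t l w) (d k)) + I (Suc m) w)))) \<partial>P)
    \<le> ennreal (exp (r + a' * (\<Sum>k\<le>m. u \<bullet> rvec (d k))))"
proof -
  let ?L = "\<lambda>x. u \<bullet> rvec x"
  \<comment> \<open>\<open>K\<close> lists the particles of generation \<open>m\<close> by lineage,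
    type and number; \<open>e\<close> maps them to driving variables, and \<open>J\<close> adds the
    immigration of generation \<open>m + 1\<close>.\<close>
  define K where "K = (SIGMA k:{..m}. SIGMA t:(UNIV :: 'n set). {..<d k $ t})"
  define e :: "nat \<times> 'n \<times> nat \<Rightarrow> (nat \<times> nat \<times> 'n \<times> nat) + nat" where "e = (\<lambda>(k, t, l). Inl (k, m, t, l))"
  define J where "J = insert (Inr (Suc m)) (e ` K)"
  have finK: "finite K"
    by (auto simp: K_def)
  have inj: "inj_on e K"
    by (auto simp: e_def inj_on_def)
  have notin: "Inr (Suc m) \<notin> e ` K"
    by (auto simp: e_def)
  have finJ: "finite J"
    using finK by (simp add: J_def)
  have JI: "J \<subseteq> UNIV <+> {1..}"
    by (auto simp: J_def e_def)
  have sumK: "(\<Sum>q\<in>K. case q of (k, t, l) \<Rightarrow> g k t l) = (\<Sum>k\<le>m. \<Sum>t\<in>UNIV. \<Sum>l<d k $ t. g k t l)"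
    for g :: "nat \<Rightarrow> 'n \<Rightarrow> nat \<Rightarrow> real"
    unfolding K_def by (subst sum.Sigma[symmetric], simp, simp)+ simp
  have prod_eq: "ennreal (exp (a * ?L ((\<Sum>k\<le>m. reproduce (\<lambda>t l. xi k m t l w) (d k)) + I (Suc m) w)))
      = (\<Prod>j\<in>J. ennreal (exp (a * ?L (driver j w))))" for w
  proof -
    have "a * ?L ((\<Sum>k\<le>m. reproduce (\<lambda>t l. xi k m t l w) (d k)) + I (Suc m) w)
        = a * ?L (I (Suc m) w) + (\<Sum>q\<in>K. case q of (k, t, l) \<Rightarrow> a * ?L (xi k m t l w))"
      by (simp add: rvec_add rvec_sum inner_add_right inner_sum_right inner_rvec_reproduce
          sumK sum_distrib_left distrib_left)
    also have "(\<Sum>q\<in>K. case q of (k, t, l) \<Rightarrow> a * ?L (xi k m t l w)) = (\<Sum>q\<in>K. a * ?L (driver (e q) w))"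
      by (intro sum.cong) (auto simp: e_def)
    also have "a * ?L (I (Suc m) w) + \<dots> = (\<Sum>j\<in>J. a * ?L (driver j w))"
      unfolding J_def using finK notin inj by (simp add: sum.reindex)
    finally show ?thesis
      using finJ by (simp add: prod_ennreal exp_sum)
  qed
  have ind: "indep_vars (\<lambda>_. borel) (\<lambda>j w. ennreal (exp (a * ?L (driver j w)))) J"
    by (rule indep_vars_compose2[OF indep_vars_subset[OF independent JI]]) simp
  have "(\<integral>\<^sup>+w. ennreal (exp (a * ?L ((\<Sum>k\<le>m. reproduce (\<lambda>t l. xi k m t l w) (d k)) + I (Suc m) w))) \<partial>P)
      = (\<Prod>j\<in>J. \<integral>\<^sup>+w. ennreal (exp (a * ?L (driver j w))) \<partial>P)"
    unfolding prod_eq by (rule indep_vars_nn_integral[OF finJ ind]) simp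
  also have "\<dots> = (\<integral>\<^sup>+w. ennreal (exp (a * ?L (I (Suc m) w))) \<partial>P)
      * (\<Prod>q\<in>K. \<integral>\<^sup>+w. ennreal (exp (a * ?L (driver (e q) w))) \<partial>P)"
    unfolding J_def using finK notin inj by (simp add: prod.reindex)
  also have "\<dots> \<le> ennreal (exp r) * (\<Prod>q\<in>K. ennreal (exp (case q of (k, t, l) \<Rightarrow> a' * u $ t)))"
  proof (intro mult_mono prod_mono_ennreal)
    show "(\<integral>\<^sup>+w. ennreal (exp (a * ?L (I (Suc m) w))) \<partial>P) \<le> ennreal (exp r)"
      using imm by (simp add: nn_integral_I[where g = "\<lambda>x. ennreal (exp (a * ?L x))"])
    show "(\<integral>\<^sup>+w. ennreal (exp (a * ?L (driver (e q) w))) \<partial>P) \<le> ennreal (exp (case q of (k, t, l) \<Rightarrow> a' * u $ t))" for q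
      using off by (auto simp: e_def nn_integral_xi[where g = "\<lambda>x. ennreal (exp (a * ?L x))"] split: prod.split)
  qed auto
  also have "\<dots> = ennreal (exp (r + (\<Sum>q\<in>K. case q of (k, t, l) \<Rightarrow> a' * u $ t)))"
    using finK by (simp add: prod_ennreal exp_sum exp_add ennreal_mult')
  also have "(\<Sum>q\<in>K. case q of (k, t, l) \<Rightarrow> a' * u $ t) = a' * (\<Sum>k\<le>m. ?L (d k))"
    by (simp add: sumK inner_rvec sum_distrib_left mult.assoc mult.commute mult.left_commute)
  finally show ?thesis .
qed

text \<open>
  Conditioning on the first \<open>m\<close> generations is done with Fubini's theorem: the variables that
  drive them and the variables of the next reproduction step form independent blocks \<open>A\<close> and \<open>B\<close>.
\<close>

lemma nn_integral_exp_bpi_Suc_le: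
  fixes z :: "nat ^ 'n"
  assumes off: "\<And>t. (\<integral>\<^sup>+x. ennreal (exp (a * (u \<bullet> rvec x))) \<partial>off t) \<le> ennreal (exp (a' * u $ t))"
    and imm: "(\<integral>\<^sup>+x. ennreal (exp (a * (u \<bullet> rvec x))) \<partial>imm) \<le> ennreal (exp r)"
    and nm: "n \<le> m"
  defines "X \<equiv> bpi xi I (\<lambda>_. z)"
  shows "(\<integral>\<^sup>+w. ennreal (exp (a * (u \<bullet> rvec (X (Suc m) w)) + b * (u \<bullet> rvec (X n w)))) \<partial>P)
    \<le> ennreal (exp r) * (\<integral>\<^sup>+w. ennreal (exp (a' * (u \<bullet> rvec (X m w)) + b * (u \<bullet> rvec (X n w)))) \<partial>P)"
proof -
  let ?L = "\<lambda>x. u \<bullet> rvec x"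
  define A :: "((nat \<times> nat \<times> 'n \<times> nat) + nat) set" where "A = {(k, r, t, l). r < m} <+> {1..m}"
  define B :: "((nat \<times> nat \<times> 'n \<times> nat) + nat) set" where "B = {(k, r, t, l). r = m} <+> {Suc m}"
  let ?PA = "PiM A (\<lambda>_. count_space UNIV :: (nat ^ 'n) measure)"
  let ?PB = "PiM B (\<lambda>_. count_space UNIV :: (nat ^ 'n) measure)"
  let ?A = "\<lambda>w. restrict (\<lambda>j. driver j w) A" and ?B = "\<lambda>w. restrict (\<lambda>j. driver j w) B"
  \<comment> \<open>With coordinate projections as driving variables, the process is rebuilt on the
    product space, as a function of the values of a block.\<close>
  define xi' :: "nat \<Rightarrow> nat \<Rightarrow> 'n \<Rightarrow> nat \<Rightarrow> ((nat \<times> nat \<times> 'n \<times> nat) + nat \<Rightarrow> nat ^ 'n) \<Rightarrow> nat ^ 'n"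
    where "xi' = (\<lambda>k r t l p. p (Inl (k, r, t, l)))"
  define I' :: "nat \<Rightarrow> ((nat \<times> nat \<times> 'n \<times> nat) + nat \<Rightarrow> nat ^ 'n) \<Rightarrow> nat ^ 'n"
    where "I' = (\<lambda>k p. p (Inr k))"
  define D where "D k = lineage xi' I' (\<lambda>_. z) k m" for k
  define Xn where "Xn = bpi xi' I' (\<lambda>_. z) n"
  define F where "F = (\<lambda>(p, q). ennreal (exp (a * ?L ((\<Sum>k\<le>m. reproduce (\<lambda>t l. xi' k m t l q) (D k p)) + I' (Suc m) q)
      + b * ?L (Xn p))))"
  have ind: "indep_var ?PA ?A ?PB ?B"
    by (rule indep_var_restrict[OF independent]) (auto simp: A_def B_def)
  have mA: "xi' k r t l \<in> measurable ?PA (count_space UNIV)" if "r < m" for k r t l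
    unfolding xi'_def using that by (intro measurable_component_singleton) (auto simp: A_def)
  have mAI: "I' k \<in> measurable ?PA (count_space UNIV)" if "1 \<le> k" "k \<le> m" for k
    unfolding I'_def using that by (intro measurable_component_singleton) (auto simp: A_def)
  have mB: "xi' k m t l \<in> measurable ?PB (count_space UNIV)" for k t l
    unfolding xi'_def by (intro measurable_component_singleton) (auto simp: B_def)
  have mBI: "I' (Suc m) \<in> measurable ?PB (count_space UNIV)"
    unfolding I'_def by (intro measurable_component_singleton) (auto simp: B_def)
  have mD: "D k \<in> measurable ?PA (count_space UNIV)" if "k \<le> m" for k
    unfolding D_def using that by (intro measurable_lineage mA mAI) auto
  have mXn: "Xn \<in> measurable ?PA (count_space UNIV)"
    unfolding Xn_def using nm by (intro measurable_bpi mA mAI) auto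
  have mX: "(\<lambda>pq. (\<Sum>k\<le>m. reproduce (\<lambda>t l. xi' k m t l (snd pq)) (D k (fst pq))) + I' (Suc m) (snd pq))
      \<in> measurable (?PA \<Otimes>\<^sub>M ?PB) (count_space UNIV)"
    by (intro measurable_add_count_space measurable_sum_count_space measurable_reproduce
        measurable_compose[OF measurable_snd mB] measurable_compose[OF measurable_snd mBI]
        measurable_compose[OF measurable_fst mD]) auto
  have mF: "F \<in> borel_measurable (?PA \<Otimes>\<^sub>M ?PB)"
  proof -
    have L: "?L \<in> borel_measurable (count_space UNIV)"
      by simp
    note [measurable] = measurable_compose[OF mX L] measurable_compose[OF measurable_compose[OF measurable_fst mXn] L]
    show ?thesis
      unfolding F_def case_prod_beta by measurable
  qed
  have DA: "D k (?A w) = lineage xi I (\<lambda>_. z) k m w" if "k \<le> m" for k w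
    unfolding D_def using that by (intro lineage_cong) (auto simp: xi'_def I'_def A_def)
  have Xm: "(\<Sum>k\<le>m. D k (?A w)) = X m w" for w
    unfolding X_def bpi_eq_sum_lineage by (intro sum.cong DA) auto
  have XnA: "Xn (?A w) = X n w" for w
    unfolding Xn_def X_def bpi_eq_sum_lineage using nm
    by (intro sum.cong lineage_cong) (auto simp: xi'_def I'_def A_def)
  have xiB: "xi' k m t l (?B w) = xi k m t l w" for k t l w
    by (auto simp: xi'_def B_def)
  have IB: "I' (Suc m) (?B w) = I (Suc m) w" for w
    by (auto simp: I'_def B_def)
  have "(\<integral>\<^sup>+w. ennreal (exp (a * ?L (X (Suc m) w) + b * ?L (X n w))) \<partial>P) = (\<integral>\<^sup>+w. F (?A w, ?B w) \<partial>P)"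
    unfolding F_def by (intro nn_integral_cong) (simp add: xiB IB DA XnA X_def bpi_Suc)
  also have "\<dots> = (\<integral>\<^sup>+w. (\<integral>\<^sup>+w'. F (?A w, ?B w') \<partial>P) \<partial>P)"
    by (rule nn_integral_indep_var[OF ind mF])
  also have "\<dots> \<le> (\<integral>\<^sup>+w. ennreal (exp r) * ennreal (exp (a' * ?L (X m w) + b * ?L (X n w))) \<partial>P)"
  proof (intro nn_integral_mono)
    \<comment> \<open>With the past frozen at \<open>w\<close>, the populations
      \<open>D k (?A w)\<close> are constants in \<open>w'\<close>, so the bound for deterministic
      populations applies to the inner integral.\<close>
    fix w
    have "(\<integral>\<^sup>+w'. F (?A w, ?B w') \<partial>P) = (\<integral>\<^sup>+w'. ennreal (exp (b * ?L (X n w)))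
        * ennreal (exp (a * ?L ((\<Sum>k\<le>m. reproduce (\<lambda>t l. xi k m t l w') (D k (?A w))) + I (Suc m) w'))) \<partial>P)"
      unfolding F_def by (intro nn_integral_cong) (simp add: xiB IB XnA exp_add ennreal_mult' mult.commute)
    also have "\<dots> = ennreal (exp (b * ?L (X n w))) * (\<integral>\<^sup>+w'.
        ennreal (exp (a * ?L ((\<Sum>k\<le>m. reproduce (\<lambda>t l. xi k m t l w') (D k (?A w))) + I (Suc m) w'))) \<partial>P)"
    proof (rule nn_integral_cmult)
      have "(\<lambda>w'. (\<Sum>k\<le>m. reproduce (\<lambda>t l. xi k m t l w') (D k (?A w))) + I (Suc m) w') \<in> measurable P (count_space UNIV)"
        by (intro measurable_add_count_space measurable_sum_count_space measurable_reproduce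
            measurable_xi measurable_I) auto
      from measurable_compose[OF this, of "\<lambda>x. ennreal (exp (a * ?L x))" borel]
      show "(\<lambda>w'. ennreal (exp (a * ?L ((\<Sum>k\<le>m. reproduce (\<lambda>t l. xi k m t l w') (D k (?A w))) + I (Suc m) w'))))
          \<in> borel_measurable P"
        by simp
    qed
    also have "\<dots> \<le> ennreal (exp (b * ?L (X n w))) * ennreal (exp (r + a' * (\<Sum>k\<le>m. ?L (D k (?A w)))))"
      by (intro mult_left_mono nn_integral_exp_generation_le off imm) auto
    also have "(\<Sum>k\<le>m. ?L (D k (?A w))) = ?L (X m w)"
      by (simp only: Xm[symmetric] rvec_sum inner_sum_right)
    also have "ennreal (exp (b * ?L (X n w))) * ennreal (exp (r + a' * ?L (X m w)))
        = ennreal (exp r) * ennreal (exp (a' * ?L (X m w) + b * ?L (X n w)))"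
      by (simp add: exp_add algebra_simps flip: ennreal_mult')
    finally show "(\<integral>\<^sup>+w'. F (?A w, ?B w') \<partial>P)
        \<le> ennreal (exp r) * ennreal (exp (a' * ?L (X m w) + b * ?L (X n w)))" .
  qed
  also have "\<dots> = ennreal (exp r) * (\<integral>\<^sup>+w. ennreal (exp (a' * ?L (X m w) + b * ?L (X n w))) \<partial>P)"
  proof (rule nn_integral_cmult)
    have L: "(\<lambda>w. ?L (X k w)) \<in> borel_measurable P" for k
      unfolding X_def by (rule measurable_compose[OF measurable_bpi_driver]) auto
    note [measurable] = L
    show "(\<lambda>w. ennreal (exp (a' * ?L (X m w) + b * ?L (X n w)))) \<in> borel_measurable P"
      by measurable
  qed
  finally show ?thesis .
qed

end

section \<open>Iteration over the generations\<close>

lemma sum_inverse_power_tail: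
  fixes r :: real
  assumes "1 < r" "n \<le> m"
  shows "(\<Sum>k\<in>{n<..m}. 1 / r ^ k) = (1 / r ^ n - 1 / r ^ m) / (r - 1)"
  using assms(2)
proof (induction m rule: dec_induct)
  case (step m)
  have "{n<..Suc m} = insert (Suc m) {n<..m}"
    using step.hyps by auto
  then have "(\<Sum>k\<in>{n<..Suc m}. 1 / r ^ k) = 1 / r ^ Suc m + (1 / r ^ n - 1 / r ^ m) / (r - 1)"
    by (simp add: step.IH del: power_Suc)
  also have "1 / r ^ Suc m = (1 / r ^ m - 1 / r ^ Suc m) / (r - 1)"
    using assms(1) by (simp add: field_simps)
  finally show ?case
    by (simp add: add_divide_distrib[symmetric] del: power_Suc)
qed simp

text \<open>Collects the constants of the iteration. For \<open>\<bar>x\<bar> \<le> \<eta>\<close>,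
  the conditions on \<eta> give
  \<open>\<bar>B x\<bar> \<le> 2 * \<bar>x\<bar> \<le> \<delta>\<close>, so a one-step error is at
  most \<open>4 * c * x\<^sup>2\<close>; \<beta> solves
  \<open>\<beta> * \<rho> * (\<rho> - 1) = 4 * c\<close>, so that
  \<open>B (\<rho> * x) - \<rho> * B x\<close> equals this error. \<gamma> bounds the quadratic cost
  of one immigration.\<close>

locale bpi_quadratic = bpi_driver P i off imm xi I Z0
  for P :: "'w measure"
    and i :: "'n::finite"
    and off :: "'n \<Rightarrow> (nat ^ 'n) pmf"
    and imm :: "(nat ^ 'n) pmf"
    and xi :: "nat \<Rightarrow> nat \<Rightarrow> 'n \<Rightarrow> nat \<Rightarrow> 'w \<Rightarrow> nat ^ 'n"
    and I :: "nat \<Rightarrow> 'w \<Rightarrow> nat ^ 'n"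
    and Z0 :: "'w \<Rightarrow> nat ^ 'n" +
  fixes u lam :: "real ^ 'n" and \<rho> c \<delta> \<beta> \<gamma> \<eta> :: real
  assumes u_nonneg: "\<And>j. 0 \<le> u $ j" and u_le_1: "u $ i \<le> 1"
    and rho: "1 < \<rho>" and c_pos: "0 < c" and drift: "0 \<le> u \<bullet> lam"
    and exp_off: "\<And>a t. \<bar>a\<bar> \<le> \<delta> \<Longrightarrow>
      (\<integral>\<^sup>+x. ennreal (exp (a * (u \<bullet> rvec x))) \<partial>off t) \<le> ennreal (exp ((\<rho> * a + c * a\<^sup>2) * u $ t))"
    and exp_imm: "\<And>a. \<bar>a\<bar> \<le> \<delta> \<Longrightarrow>
      (\<integral>\<^sup>+x. ennreal (exp (a * (u \<bullet> rvec x))) \<partial>imm) \<le> ennreal (exp (a * (u \<bullet> lam) + c * a\<^sup>2))"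
    and beta_def: "\<beta> = 4 * c / (\<rho> * (\<rho> - 1))"
    and gamma_def: "\<gamma> = \<beta> * (u \<bullet> lam) + 4 * c"
    and eta: "0 < \<eta>" "2 * \<eta> \<le> \<delta>" "\<beta> * \<eta> \<le> 1"
begin

abbreviation L :: "nat ^ 'n \<Rightarrow> real" where "L x \<equiv> u \<bullet> rvec x"

text \<open>The start is deterministic because \<open>Z0\<close> equals \<open>axis i 1\<close> only
  almost surely and is not among the independent driving variables.\<close>

definition X :: "nat \<Rightarrow> 'w \<Rightarrow> nat ^ 'n" where "X = bpi xi I (\<lambda>_. axis i 1)"

definition B :: "real \<Rightarrow> real" where "B x = x + \<beta> * x\<^sup>2"

text \<open>Exponent of the final moment bound. One term
  \<open>\<gamma> * \<eta>\<^sup>2 / (\<rho> - 1)\<close> comes from generations \<open>n\<close> to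
  \<open>m\<close>; the other, with the drift term, from generations 0 to \<open>n\<close>;
  \<open>\<eta> + \<beta> * \<eta>\<^sup>2\<close>, which is \<open>B \<eta>\<close>, comes from the
  initial particle.\<close>

definition K :: real where
  "K = (\<eta> * (u \<bullet> lam) + 2 * \<gamma> * \<eta>\<^sup>2) / (\<rho> - 1) + \<eta> + \<beta> * \<eta>\<^sup>2"

lemma beta_pos: "0 < \<beta>"
  using c_pos rho by (simp add: beta_def)

lemma beta_eta_square: "\<beta> * \<eta>\<^sup>2 \<le> \<eta>"
  using mult_right_mono[OF eta(3), of \<eta>] eta(1) by (simp add: power2_eq_square mult.assoc)

lemma gamma_nonneg: "0 \<le> \<gamma>"
  using beta_pos drift c_pos by (simp add: gamma_def)

lemma L_X_nonneg: "0 \<le> L (X n w)"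
  by (intro inner_rvec_nonneg u_nonneg)

lemma measurable_L_X [measurable]: "(\<lambda>w. L (X n w)) \<in> borel_measurable P"
  unfolding X_def by (rule measurable_compose[OF measurable_bpi_driver]) auto

text \<open>\<open>B\<close> is a supersolution of the recursion \<open>x \<mapsto> \<rho> x + c x\<^sup>2\<close> for the exponents.\<close>

lemma B_bounds:
  assumes "\<bar>x\<bar> \<le> \<eta>"
  shows "\<bar>B x\<bar> \<le> \<delta>" "\<rho> * B x + c * (B x)\<^sup>2 \<le> B (\<rho> * x)"
    "B x * (u \<bullet> lam) + c * (B x)\<^sup>2 \<le> x * (u \<bullet> lam) + \<gamma> * x\<^sup>2"
proof -
  have "\<bar>\<beta> * x\<bar> \<le> \<beta> * \<eta>"
    using beta_pos assms by (simp add: abs_mult)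
  then have bx: "\<bar>\<beta> * x\<bar> \<le> 1"
    using eta(3) by linarith
  have Bx: "B x = x * (1 + \<beta> * x)"
    by (simp add: B_def power2_eq_square algebra_simps)
  have abs1: "\<bar>1 + \<beta> * x\<bar> \<le> 2"
    using bx by linarith
  have B2: "\<bar>B x\<bar> \<le> 2 * \<bar>x\<bar>"
    unfolding Bx abs_mult using mult_left_mono[OF abs1, of "\<bar>x\<bar>"] by simp
  then show "\<bar>B x\<bar> \<le> \<delta>"
    using assms eta(2) by linarith
  have "(B x)\<^sup>2 \<le> (2 * \<bar>x\<bar>)\<^sup>2"
    using power_mono[OF B2, of 2] by simp
  then have sq: "c * (B x)\<^sup>2 \<le> 4 * c * x\<^sup>2"
    using c_pos by (simp add: power_mult_distrib)
  have "\<beta> * (\<rho> * (\<rho> - 1)) = 4 * c"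
    using rho by (simp add: beta_def)
  then have "4 * c * x\<^sup>2 = \<beta> * (\<rho> * (\<rho> - 1)) * x\<^sup>2"
    by simp
  also have "\<dots> = B (\<rho> * x) - \<rho> * B x"
    by (simp add: B_def power2_eq_square algebra_simps)
  finally show "\<rho> * B x + c * (B x)\<^sup>2 \<le> B (\<rho> * x)"
    using sq by linarith
  show "B x * (u \<bullet> lam) + c * (B x)\<^sup>2 \<le> x * (u \<bullet> lam) + \<gamma> * x\<^sup>2"
    using sq by (simp add: B_def gamma_def algebra_simps)
qed

text \<open>Each step back from generation \<open>m + 1\<close> turns the exponent
  \<open>B x\<close> at \<open>x = \<tau> / \<rho> ^ Suc m\<close> into at most
  \<open>B (\<rho> * x)\<close>, the exponent belonging to generation \<open>m\<close>, and leaves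
  the immigration cost as a factor. The term with \<open>b\<close> is carried along so that
  generation \<open>n\<close> can later be subtracted.\<close>

lemma nn_integral_exp_iterate:
  assumes tau: "\<bar>\<tau>\<bar> / \<rho> ^ n \<le> \<eta>" and nm: "n \<le> m"
  shows "(\<integral>\<^sup>+w. ennreal (exp (B (\<tau> / \<rho> ^ m) * L (X m w) + b * L (X n w))) \<partial>P)
    \<le> ennreal (exp (\<Sum>k\<in>{n<..m}. \<tau> / \<rho> ^ k * (u \<bullet> lam) + \<gamma> * (\<tau> / \<rho> ^ k)\<^sup>2))
      * (\<integral>\<^sup>+w. ennreal (exp ((B (\<tau> / \<rho> ^ n) + b) * L (X n w))) \<partial>P)"
  using nm
proof (induction m rule: dec_induct)
  case base
  then show ?case
    by (simp add: algebra_simps)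
next
  case (step m)
  define x where "x = \<tau> / \<rho> ^ Suc m"
  define S where "S m = (\<Sum>k\<in>{n<..m}. \<tau> / \<rho> ^ k * (u \<bullet> lam) + \<gamma> * (\<tau> / \<rho> ^ k)\<^sup>2)" for m
  have rx: "\<rho> * x = \<tau> / \<rho> ^ m"
    using rho by (simp add: x_def)
  have "\<bar>x\<bar> = \<bar>\<tau>\<bar> / \<rho> ^ Suc m"
    using rho by (simp add: x_def abs_mult)
  also have "\<dots> \<le> \<bar>\<tau>\<bar> / \<rho> ^ n"
    using rho step.hyps by (intro divide_left_mono power_increasing) auto
  finally have x: "\<bar>x\<bar> \<le> \<eta>"
    using tau by linarith
  have SS: "S (Suc m) = x * (u \<bullet> lam) + \<gamma> * x\<^sup>2 + S m"
  proof -
    have "{n<..Suc m} = insert (Suc m) {n<..m}"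
      using step.hyps by auto
    then show ?thesis
      by (simp add: S_def x_def)
  qed
  have "(\<integral>\<^sup>+w. ennreal (exp (B x * L (X (Suc m) w) + b * L (X n w))) \<partial>P)
      \<le> ennreal (exp (B x * (u \<bullet> lam) + c * (B x)\<^sup>2))
        * (\<integral>\<^sup>+w. ennreal (exp ((\<rho> * B x + c * (B x)\<^sup>2) * L (X m w) + b * L (X n w))) \<partial>P)"
    unfolding X_def using step.hyps(1)
    by (intro nn_integral_exp_bpi_Suc_le exp_off exp_imm B_bounds(1)[OF x])
  \<comment> \<open>Enlarging the exponent is legitimate because \<open>L (X m w)\<close> is
    nonnegative.\<close>
  also have "\<dots> \<le> ennreal (exp (x * (u \<bullet> lam) + \<gamma> * x\<^sup>2))
        * (\<integral>\<^sup>+w. ennreal (exp (B (\<tau> / \<rho> ^ m) * L (X m w) + b * L (X n w))) \<partial>P)"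
    using B_bounds(2,3)[OF x] unfolding rx
    by (intro mult_mono nn_integral_mono ennreal_leI) (auto intro!: mult_right_mono L_X_nonneg)
  also have "\<dots> \<le> ennreal (exp (x * (u \<bullet> lam) + \<gamma> * x\<^sup>2))
        * (ennreal (exp (S m)) * (\<integral>\<^sup>+w. ennreal (exp ((B (\<tau> / \<rho> ^ n) + b) * L (X n w))) \<partial>P))"
    using step.IH unfolding S_def by (intro mult_left_mono) auto
  also have "\<dots> = ennreal (exp (S (Suc m))) * (\<integral>\<^sup>+w. ennreal (exp ((B (\<tau> / \<rho> ^ n) + b) * L (X n w))) \<partial>P)"
    by (simp add: SS exp_add ennreal_mult' mult.assoc)
  finally show ?case
    unfolding x_def S_def .
qed

text \<open>As \<open>\<rho> ^ n \<le> \<rho> ^ k\<close>, the term for \<open>k\<close> is at most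
  \<open>\<eta>\<^sup>2 / \<rho> ^ k\<close>, and the geometric sum is bounded uniformly in
  \<open>n\<close> and \<open>m\<close>. Hence \<tau> may grow like the square root of
  \<open>\<rho> ^ n\<close>.\<close>

lemma sum_square_tail_le:
  assumes "\<tau>\<^sup>2 \<le> \<eta>\<^sup>2 * \<rho> ^ n" "n \<le> m"
  shows "(\<Sum>k\<in>{n<..m}. (\<tau> / \<rho> ^ k)\<^sup>2) \<le> \<eta>\<^sup>2 / (\<rho> - 1)"
proof -
  have "(\<Sum>k\<in>{n<..m}. (\<tau> / \<rho> ^ k)\<^sup>2) \<le> (\<Sum>k\<in>{n<..m}. \<eta>\<^sup>2 * (1 / \<rho> ^ k))"
  proof (rule sum_mono)
    fix k assume k: "k \<in> {n<..m}"
    have "\<tau>\<^sup>2 \<le> \<eta>\<^sup>2 * \<rho> ^ k"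
      using assms(1) mult_left_mono[OF power_increasing[of n k \<rho>], of "\<eta>\<^sup>2"] k rho by simp
    then show "(\<tau> / \<rho> ^ k)\<^sup>2 \<le> \<eta>\<^sup>2 * (1 / \<rho> ^ k)"
      using rho by (simp add: field_simps power2_eq_square)
  qed
  also have "\<dots> = \<eta>\<^sup>2 * ((1 / \<rho> ^ n - 1 / \<rho> ^ m) / (\<rho> - 1))"
    by (simp only: sum_distrib_left[symmetric] sum_inverse_power_tail[OF rho assms(2)])
  also have "\<dots> \<le> \<eta>\<^sup>2 * (1 / (\<rho> - 1))"
  proof (intro mult_left_mono divide_right_mono)
    have "1 / \<rho> ^ n \<le> 1" "0 \<le> 1 / \<rho> ^ m"
      using rho one_le_power[of \<rho> n] by (auto simp: field_simps)
    then show "1 / \<rho> ^ n - 1 / \<rho> ^ m \<le> 1"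
      by linarith
  qed (use rho in auto)
  finally show ?thesis
    by simp
qed

text \<open>A uniform exponential moment of the normalized process, by iterating with \<tau> =
  \<eta> and \<open>b = 0\<close> down to generation 0, where the single particle contributes at
  most \<open>B \<eta>\<close>.\<close>

lemma nn_integral_exp_normalized_le:
  assumes a: "0 \<le> a" "a \<le> \<eta>"
  shows "(\<integral>\<^sup>+w. ennreal (exp (a / \<rho> ^ n * L (X n w))) \<partial>P)
    \<le> ennreal (exp ((\<eta> * (u \<bullet> lam) + \<gamma> * \<eta>\<^sup>2) / (\<rho> - 1) + \<eta> + \<beta> * \<eta>\<^sup>2))"
proof -
  \<comment> \<open>The zero term \<open>0 * L (X 0 w)\<close> brings the integrand into the form of
    the iteration that ends in generation 0.\<close>
  have "(\<integral>\<^sup>+w. ennreal (exp (a / \<rho> ^ n * L (X n w))) \<partial>P)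
      \<le> (\<integral>\<^sup>+w. ennreal (exp (B (\<eta> / \<rho> ^ n) * L (X n w) + 0 * L (X 0 w))) \<partial>P)"
  proof (intro nn_integral_mono ennreal_leI)
    fix w
    have "a / \<rho> ^ n \<le> \<eta> / \<rho> ^ n"
      using a rho by (intro divide_right_mono) auto
    also have "\<dots> \<le> B (\<eta> / \<rho> ^ n)"
      using beta_pos by (simp add: B_def)
    finally have "a / \<rho> ^ n * L (X n w) \<le> B (\<eta> / \<rho> ^ n) * L (X n w)"
      by (intro mult_right_mono L_X_nonneg)
    then show "exp (a / \<rho> ^ n * L (X n w)) \<le> exp (B (\<eta> / \<rho> ^ n) * L (X n w) + 0 * L (X 0 w))"
      by simp
  qed
  also have "\<dots> \<le> ennreal (exp (\<Sum>k\<in>{0<..n}. \<eta> / \<rho> ^ k * (u \<bullet> lam) + \<gamma> * (\<eta> / \<rho> ^ k)\<^sup>2))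
      * (\<integral>\<^sup>+w. ennreal (exp ((B (\<eta> / \<rho> ^ 0) + 0) * L (X 0 w))) \<partial>P)"
    using eta by (intro nn_integral_exp_iterate) auto
  also have "\<dots> \<le> ennreal (exp ((\<eta> * (u \<bullet> lam) + \<gamma> * \<eta>\<^sup>2) / (\<rho> - 1))) * ennreal (exp (\<eta> + \<beta> * \<eta>\<^sup>2))"
  proof (intro mult_mono ennreal_leI)
    have "(\<Sum>k\<in>{0<..n}. \<eta> / \<rho> ^ k * (u \<bullet> lam)) = (\<eta> * (u \<bullet> lam)) * (\<Sum>k\<in>{0<..n}. 1 / \<rho> ^ k)"
      by (simp add: sum_distrib_left)
    also have "(\<Sum>k\<in>{0<..n}. 1 / \<rho> ^ k) \<le> 1 / (\<rho> - 1)"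
      unfolding sum_inverse_power_tail[OF rho le0] using rho by (intro divide_right_mono) auto
    finally have 1: "(\<Sum>k\<in>{0<..n}. \<eta> / \<rho> ^ k * (u \<bullet> lam)) \<le> (\<eta> * (u \<bullet> lam)) * (1 / (\<rho> - 1))"
      using eta drift by (simp add: mult_left_mono)
    have 2: "\<gamma> * (\<Sum>k\<in>{0<..n}. (\<eta> / \<rho> ^ k)\<^sup>2) \<le> \<gamma> * (\<eta>\<^sup>2 / (\<rho> - 1))"
      by (intro mult_left_mono sum_square_tail_le gamma_nonneg) auto
    show "exp (\<Sum>k\<in>{0<..n}. \<eta> / \<rho> ^ k * (u \<bullet> lam) + \<gamma> * (\<eta> / \<rho> ^ k)\<^sup>2)
        \<le> exp ((\<eta> * (u \<bullet> lam) + \<gamma> * \<eta>\<^sup>2) / (\<rho> - 1))"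
      using 1 2 by (simp add: sum.distrib sum_distrib_left add_divide_distrib)
    have "X 0 w = axis i 1" for w
      by (simp add: X_def bpi_def)
    moreover have "(\<eta> + \<beta> * \<eta>\<^sup>2) * u $ i \<le> \<eta> + \<beta> * \<eta>\<^sup>2"
      using mult_left_mono[OF u_le_1, of "\<eta> + \<beta> * \<eta>\<^sup>2"] eta beta_pos by simp
    ultimately show "(\<integral>\<^sup>+w. ennreal (exp ((B (\<eta> / \<rho> ^ 0) + 0) * L (X 0 w))) \<partial>P) \<le> ennreal (exp (\<eta> + \<beta> * \<eta>\<^sup>2))"
      by (simp add: inner_rvec_axis B_def emeasure_space_1 ennreal_leI del: One_nat_def)
  qed auto
  also have "\<dots> = ennreal (exp ((\<eta> * (u \<bullet> lam) + \<gamma> * \<eta>\<^sup>2) / (\<rho> - 1) + \<eta> + \<beta> * \<eta>\<^sup>2))"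
    by (simp add: exp_add ennreal_mult' mult.assoc)
  finally show ?thesis .
qed

text \<open>The centring is kept as a sum over generations so that it cancels the linear immigration
  costs of the iteration term by term.\<close>

lemma Y_seq_diff:
  assumes "n \<le> m"
  shows "Y_seq \<rho> u lam X m w - Y_seq \<rho> u lam X n w
    = 1 / \<rho> ^ m * L (X m w) - 1 / \<rho> ^ n * L (X n w) - (\<Sum>k\<in>{n<..m}. 1 / \<rho> ^ k) * (u \<bullet> lam)"
proof -
  have eq: "Y_seq \<rho> u lam X k w = 1 / \<rho> ^ k * L (X k w) - (\<rho> - 1 / \<rho> ^ k) / (\<rho> - 1) * (u \<bullet> lam)" for k
    using rho by (simp add: Y_seq_def field_simps)
  show ?thesis
    unfolding eq sum_inverse_power_tail[OF rho assms]
    by (simp add: diff_divide_distrib algebra_simps)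
qed

text \<open>Iterate with \<open>b = - (\<tau> / \<rho> ^ n)\<close>. The linear immigration costs
  cancel against the centring, and the exponent left on \<open>L (X n w)\<close> is the quadratic
  part \<open>\<beta> * \<eta>\<^sup>2 / \<rho> ^ n\<close>, covered by the uniform moment since
  \<open>\<beta> * \<eta>\<^sup>2 \<le> \<eta>\<close>.\<close>

lemma nn_integral_exp_Y_diff_le:
  assumes nm: "n \<le> m" and tau: "\<tau>\<^sup>2 = \<eta>\<^sup>2 * \<rho> ^ n"
  shows "(\<integral>\<^sup>+w. ennreal (exp (\<tau> * (Y_seq \<rho> u lam X m w - Y_seq \<rho> u lam X n w))) \<partial>P) \<le> ennreal (exp K)"
proof -
  let ?S = "\<Sum>k\<in>{n<..m}. 1 / \<rho> ^ k"
  have r1: "1 \<le> \<rho> ^ n"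
    using rho by simp
  \<comment> \<open>Despite its growth in \<open>n\<close>, \<tau> is admissible for the iteration:
    \<open>\<bar>\<tau>\<bar> / \<rho> ^ n\<close> is \<eta> divided by the square root of
    \<open>\<rho> ^ n\<close>.\<close>
  have sq: "(\<tau> / \<rho> ^ n)\<^sup>2 = \<eta>\<^sup>2 / \<rho> ^ n"
    unfolding power_divide tau using rho by (simp add: power2_eq_square)
  also have "\<dots> \<le> \<eta>\<^sup>2"
    using mult_left_mono[OF r1, of "\<eta>\<^sup>2"] rho by (simp add: field_simps)
  finally have "(\<bar>\<tau>\<bar> / \<rho> ^ n)\<^sup>2 \<le> \<eta>\<^sup>2"
    by (simp add: power_divide)
  then have tn: "\<bar>\<tau>\<bar> / \<rho> ^ n \<le> \<eta>"
    using eta(1) by (intro power2_le_imp_le[of "\<bar>\<tau>\<bar> / \<rho> ^ n" \<eta>]) auto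
  have S1: "(\<Sum>k\<in>{n<..m}. \<tau> / \<rho> ^ k * (u \<bullet> lam) + \<gamma> * (\<tau> / \<rho> ^ k)\<^sup>2) - \<tau> * ?S * (u \<bullet> lam)
      = \<gamma> * (\<Sum>k\<in>{n<..m}. (\<tau> / \<rho> ^ k)\<^sup>2)"
    by (simp add: sum.distrib sum_distrib_left sum_distrib_right)
  also have "\<dots> \<le> \<gamma> * (\<eta>\<^sup>2 / (\<rho> - 1))"
    using nm tau by (intro mult_left_mono sum_square_tail_le gamma_nonneg) auto
  finally have S: "(\<Sum>k\<in>{n<..m}. \<tau> / \<rho> ^ k * (u \<bullet> lam) + \<gamma> * (\<tau> / \<rho> ^ k)\<^sup>2) - \<tau> * ?S * (u \<bullet> lam)
      \<le> \<gamma> * \<eta>\<^sup>2 / (\<rho> - 1)"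
    by simp
  have Bb: "B (\<tau> / \<rho> ^ n) + - (\<tau> / \<rho> ^ n) = \<beta> * \<eta>\<^sup>2 / \<rho> ^ n"
    by (simp add: B_def sq)
  have "(\<integral>\<^sup>+w. ennreal (exp (\<tau> * (Y_seq \<rho> u lam X m w - Y_seq \<rho> u lam X n w))) \<partial>P)
      \<le> (\<integral>\<^sup>+w. ennreal (exp (- (\<tau> * ?S * (u \<bullet> lam))))
          * ennreal (exp (B (\<tau> / \<rho> ^ m) * L (X m w) + - (\<tau> / \<rho> ^ n) * L (X n w))) \<partial>P)"
  proof (intro nn_integral_mono)
    fix w
    \<comment> \<open>\<open>B x\<close> exceeds \<open>x\<close> by a nonnegative square, so the
      exponent can be enlarged to the form required by the iteration for either sign of
      \<tau>.\<close>
    have "\<tau> / \<rho> ^ m * L (X m w) \<le> B (\<tau> / \<rho> ^ m) * L (X m w)"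
      using beta_pos by (intro mult_right_mono L_X_nonneg) (simp add: B_def)
    then have "\<tau> * (Y_seq \<rho> u lam X m w - Y_seq \<rho> u lam X n w)
        \<le> - (\<tau> * ?S * (u \<bullet> lam)) + (B (\<tau> / \<rho> ^ m) * L (X m w) + - (\<tau> / \<rho> ^ n) * L (X n w))"
      unfolding Y_seq_diff[OF nm] by (simp add: algebra_simps)
    then show "ennreal (exp (\<tau> * (Y_seq \<rho> u lam X m w - Y_seq \<rho> u lam X n w)))
        \<le> ennreal (exp (- (\<tau> * ?S * (u \<bullet> lam))))
          * ennreal (exp (B (\<tau> / \<rho> ^ m) * L (X m w) + - (\<tau> / \<rho> ^ n) * L (X n w)))"
      by (simp add: ennreal_leI flip: ennreal_mult' exp_add)
  qed
  also have "\<dots> = ennreal (exp (- (\<tau> * ?S * (u \<bullet> lam))))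
      * (\<integral>\<^sup>+w. ennreal (exp (B (\<tau> / \<rho> ^ m) * L (X m w) + - (\<tau> / \<rho> ^ n) * L (X n w))) \<partial>P)"
    by (rule nn_integral_cmult) measurable
  also have "\<dots> \<le> ennreal (exp (- (\<tau> * ?S * (u \<bullet> lam))))
      * (ennreal (exp (\<Sum>k\<in>{n<..m}. \<tau> / \<rho> ^ k * (u \<bullet> lam) + \<gamma> * (\<tau> / \<rho> ^ k)\<^sup>2))
        * (\<integral>\<^sup>+w. ennreal (exp ((B (\<tau> / \<rho> ^ n) + - (\<tau> / \<rho> ^ n)) * L (X n w))) \<partial>P))"
    by (intro mult_left_mono nn_integral_exp_iterate tn nm) auto
  also have "\<dots> = ennreal (exp ((\<Sum>k\<in>{n<..m}. \<tau> / \<rho> ^ k * (u \<bullet> lam) + \<gamma> * (\<tau> / \<rho> ^ k)\<^sup>2) - \<tau> * ?S * (u \<bullet> lam)))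
        * (\<integral>\<^sup>+w. ennreal (exp (\<beta> * \<eta>\<^sup>2 / \<rho> ^ n * L (X n w))) \<partial>P)"
    unfolding Bb mult.assoc[symmetric] ennreal_mult'[OF exp_ge_zero, symmetric] exp_add[symmetric] by simp
  also have "\<dots> \<le> ennreal (exp (\<gamma> * \<eta>\<^sup>2 / (\<rho> - 1)))
      * ennreal (exp ((\<eta> * (u \<bullet> lam) + \<gamma> * \<eta>\<^sup>2) / (\<rho> - 1) + \<eta> + \<beta> * \<eta>\<^sup>2))"
    using S beta_eta_square beta_pos by (intro mult_mono nn_integral_exp_normalized_le ennreal_leI) auto
  also have "\<dots> = ennreal (exp K)"
    by (simp add: K_def add_divide_distrib algebra_simps flip: ennreal_mult' exp_add)
  finally show ?thesis .
qed

section \<open>Passage to the limit and tail probabilities\<close>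

lemma measurable_Y_seq [measurable]: "Y_seq \<rho> u lam X n \<in> borel_measurable P"
  unfolding Y_seq_def[abs_def] by measurable

text \<open>Fatou's lemma along the generations \<open>n + m\<close>, all at least \<open>n\<close>,
  carries the bound uniform in \<open>m\<close> over to the limit.\<close>

lemma nn_integral_exp_limit_le:
  assumes Y[measurable]: "Y \<in> borel_measurable P"
    and lim: "AE w in P. (\<lambda>n. Y_seq \<rho> u lam X n w) \<longlonglongrightarrow> Y w"
    and tau: "\<tau>\<^sup>2 = \<eta>\<^sup>2 * \<rho> ^ n"
  shows "(\<integral>\<^sup>+w. ennreal (exp (\<tau> * (Y w - Y_seq \<rho> u lam X n w))) \<partial>P) \<le> ennreal (exp K)"
proof -
  have "(\<integral>\<^sup>+w. ennreal (exp (\<tau> * (Y w - Y_seq \<rho> u lam X n w))) \<partial>P)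
      = (\<integral>\<^sup>+w. liminf (\<lambda>m. ennreal (exp (\<tau> * (Y_seq \<rho> u lam X (n + m) w - Y_seq \<rho> u lam X n w)))) \<partial>P)"
  proof (rule nn_integral_cong_AE, use lim in eventually_elim)
    fix w assume "(\<lambda>n. Y_seq \<rho> u lam X n w) \<longlonglongrightarrow> Y w"
    then have "(\<lambda>m. Y_seq \<rho> u lam X (n + m) w) \<longlonglongrightarrow> Y w"
      by (subst add.commute) (rule LIMSEQ_ignore_initial_segment)
    then have "(\<lambda>m. ennreal (exp (\<tau> * (Y_seq \<rho> u lam X (n + m) w - Y_seq \<rho> u lam X n w))))
        \<longlonglongrightarrow> ennreal (exp (\<tau> * (Y w - Y_seq \<rho> u lam X n w)))"
      by (intro tendsto_intros)
    then show "ennreal (exp (\<tau> * (Y w - Y_seq \<rho> u lam X n w)))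
        = liminf (\<lambda>m. ennreal (exp (\<tau> * (Y_seq \<rho> u lam X (n + m) w - Y_seq \<rho> u lam X n w))))"
      by (rule lim_imp_Liminf[OF sequentially_bot, symmetric])
  qed
  also have "\<dots> \<le> liminf (\<lambda>m. \<integral>\<^sup>+w. ennreal (exp (\<tau> * (Y_seq \<rho> u lam X (n + m) w - Y_seq \<rho> u lam X n w))) \<partial>P)"
    by (rule nn_integral_liminf) measurable
  also have "\<dots> \<le> liminf (\<lambda>m::nat. ennreal (exp K))"
    by (intro Liminf_mono always_eventually allI nn_integral_exp_Y_diff_le[OF _ tau]) simp
  also have "\<dots> = ennreal (exp K)"
    by (simp add: Liminf_const)
  finally show ?thesis .
qed

text \<open>Chernoff's bound. The factor \<open>s\<close> stays on both sides of the event so that a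
  negative \<open>s\<close> yields the lower tail.\<close>

lemma prob_ge_le_exp:
  assumes [measurable]: "f \<in> borel_measurable P"
    and "(\<integral>\<^sup>+w. ennreal (exp (s * f w)) \<partial>P) \<le> ennreal C" "0 \<le> C"
  shows "prob {w \<in> space P. s * \<epsilon> \<le> s * f w} \<le> C * exp (- (s * \<epsilon>))"
proof -
  have "emeasure P {w \<in> space P. s * \<epsilon> \<le> s * f w}
      \<le> emeasure P {w \<in> space P. 1 \<le> ennreal (exp (- (s * \<epsilon>))) * ennreal (exp (s * f w))}"
  proof (rule emeasure_mono)
    show "{w \<in> space P. s * \<epsilon> \<le> s * f w}
        \<subseteq> {w \<in> space P. 1 \<le> ennreal (exp (- (s * \<epsilon>))) * ennreal (exp (s * f w))}"
      by (auto simp flip: ennreal_mult' exp_add)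
  qed measurable
  also have "\<dots> \<le> ennreal (exp (- (s * \<epsilon>))) * (\<integral>\<^sup>+w. ennreal (exp (s * f w)) * indicator (space P) w \<partial>P)"
    by (rule nn_integral_Markov_inequality) measurable
  also have "(\<integral>\<^sup>+w. ennreal (exp (s * f w)) * indicator (space P) w \<partial>P) = (\<integral>\<^sup>+w. ennreal (exp (s * f w)) \<partial>P)"
    by (intro nn_integral_cong) simp
  also have "ennreal (exp (- (s * \<epsilon>))) * \<dots> \<le> ennreal (exp (- (s * \<epsilon>))) * ennreal C"
    by (intro mult_left_mono assms) auto
  also have "\<dots> = ennreal (C * exp (- (s * \<epsilon>)))"
    using assms(3) by (simp add: mult.commute flip: ennreal_mult')
  finally show ?thesis
    using assms(3) by (simp add: emeasure_eq_measure)
qed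

lemma prob_Y_diff_le:
  assumes Y[measurable]: "Y \<in> borel_measurable P"
    and lim: "AE w in P. (\<lambda>n. Y_seq \<rho> u lam X n w) \<longlonglongrightarrow> Y w"

  shows "prob {w \<in> space P. \<bar>Y_seq \<rho> u lam X n w - Y w\<bar> > \<epsilon>} \<le> 2 * exp K * exp (- (\<eta> * sqrt \<rho> ^ n * \<epsilon>))"
proof -
  \<comment> \<open>Chosen so that both \<open>s\<close> and \<open>- s\<close> satisfy the
    condition on \<tau> in the moment bound for the limit.\<close>
  define s where "s = \<eta> * sqrt \<rho> ^ n"
  have s: "0 < s" "s\<^sup>2 = \<eta>\<^sup>2 * \<rho> ^ n"
    using eta rho by (auto simp: s_def power_mult_distrib power2_eq_square simp flip: power_mult_distrib)
  let ?D = "\<lambda>w. Y w - Y_seq \<rho> u lam X n w"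
  have 1: "prob {w \<in> space P. s * \<epsilon> \<le> s * ?D w} \<le> exp K * exp (- (s * \<epsilon>))"
    by (intro prob_ge_le_exp nn_integral_exp_limit_le[OF Y lim] s) auto
  have 2: "prob {w \<in> space P. (- s) * (- \<epsilon>) \<le> (- s) * ?D w} \<le> exp K * exp (- ((- s) * (- \<epsilon>)))"
    using s by (intro prob_ge_le_exp nn_integral_exp_limit_le[OF Y lim]) auto
  have "prob {w \<in> space P. \<bar>Y_seq \<rho> u lam X n w - Y w\<bar> > \<epsilon>}
      \<le> prob ({w \<in> space P. s * \<epsilon> \<le> s * ?D w} \<union> {w \<in> space P. (- s) * (- \<epsilon>) \<le> (- s) * ?D w})"
  proof (rule finite_measure_mono)
    show "{w \<in> space P. \<bar>Y_seq \<rho> u lam X n w - Y w\<bar> > \<epsilon>}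
        \<subseteq> {w \<in> space P. s * \<epsilon> \<le> s * ?D w} \<union> {w \<in> space P. (- s) * (- \<epsilon>) \<le> (- s) * ?D w}"
    proof
      fix w assume w: "w \<in> {w \<in> space P. \<bar>Y_seq \<rho> u lam X n w - Y w\<bar> > \<epsilon>}"
      then have "\<epsilon> \<le> ?D w \<or> \<epsilon> \<le> - ?D w"
        by auto
      then have "s * \<epsilon> \<le> s * ?D w \<or> s * \<epsilon> \<le> s * (- ?D w)"
        using s(1) by (meson less_imp_le mult_left_mono)
      with w show "w \<in> {w \<in> space P. s * \<epsilon> \<le> s * ?D w} \<union> {w \<in> space P. (- s) * (- \<epsilon>) \<le> (- s) * ?D w}"
        by (simp add: algebra_simps)
    qed
  qed measurable
  also have "\<dots> \<le> prob {w \<in> space P. s * \<epsilon> \<le> s * ?D w} + prob {w \<in> space P. (- s) * (- \<epsilon>) \<le> (- s) * ?D w}"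
    by (rule measure_Un_le) measurable
  finally show ?thesis
    using 1 2 by (simp add: s_def mult.assoc)
qed

text \<open>Almost surely \<open>Z0\<close> is the unit vector, so the process and its version with
  deterministic start agree in all generations simultaneously.\<close>

lemma prob_bpi_Y_diff_le:
  assumes Y[measurable]: "Y \<in> borel_measurable P"
    and lim: "AE w in P. (\<lambda>n. Y_seq \<rho> u lam (bpi xi I Z0) n w) \<longlonglongrightarrow> Y w"
  shows "prob {w \<in> space P. \<bar>Y_seq \<rho> u lam (bpi xi I Z0) n w - Y w\<bar> > \<epsilon>}
    \<le> 2 * exp K * exp (- (\<eta> * sqrt \<rho> ^ n * \<epsilon>))"
proof -
  have eq: "AE w in P. \<forall>n. Y_seq \<rho> u lam (bpi xi I Z0) n w = Y_seq \<rho> u lam X n w"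
    using Z0_start by eventually_elim (simp add: X_def Y_seq_def bpi_def)
  have "(\<lambda>w. L (bpi xi I Z0 n w)) \<in> borel_measurable P"
    by (rule measurable_compose[OF measurable_bpi_driver[OF Z0_measurable]]) auto
  then have [measurable]: "Y_seq \<rho> u lam (bpi xi I Z0) n \<in> borel_measurable P"
    unfolding Y_seq_def[abs_def] by measurable
  have "prob {w \<in> space P. \<bar>Y_seq \<rho> u lam (bpi xi I Z0) n w - Y w\<bar> > \<epsilon>}
      = prob {w \<in> space P. \<bar>Y_seq \<rho> u lam X n w - Y w\<bar> > \<epsilon>}"
    by (rule finite_measure_eq_AE) (use eq in \<open>auto elim: eventually_mono\<close>, measurable)
  also have "\<dots> \<le> 2 * exp K * exp (- (\<eta> * sqrt \<rho> ^ n * \<epsilon>))"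
  proof (rule prob_Y_diff_le[OF Y])
    show "AE w in P. (\<lambda>n. Y_seq \<rho> u lam X n w) \<longlonglongrightarrow> Y w"
      using lim eq by eventually_elim simp
  qed
  finally show ?thesis .
qed

end

section \<open>Moments of the offspring and immigration laws\<close>

lemma reproduce_axis: "reproduce x (axis i 1) = x i 0"
proof -
  have "reproduce x (axis i 1) = (\<Sum>t\<in>UNIV. if t = i then x i 0 else 0)"
    unfolding reproduce_def by (intro sum.cong) (auto simp: axis_def)
  then show ?thesis
    by simp
qed

text \<open>Generation 1 is almost surely the sum of one offspring vector and one immigration
  vector. Both have nonnegative entries, so each exponential is dominated by that of the
  sum.\<close>

lemma (in bpi_driver) integrable_exp_laws:
  assumes th: "0 < \<theta>" and int: "integrable P (\<lambda>w. exp (\<theta> * (1 \<bullet> rvec (bpi xi I Z0 1 w))))"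
  shows "integrable (measure_pmf (off i)) (\<lambda>x. exp (\<theta> * (1 \<bullet> rvec x)))"
    and "integrable (measure_pmf imm) (\<lambda>x. exp (\<theta> * (1 \<bullet> rvec x)))"
proof -
  have X1: "AE w in P. bpi xi I Z0 1 w = xi 0 0 i 0 w + I 1 w"
    using Z0_start
    by eventually_elim (simp add: bpi_Suc lineage_self reproduce_axis[unfolded One_nat_def])
  have nn: "0 \<le> 1 \<bullet> rvec x" for x :: "nat ^ 'n"
    by (intro inner_rvec_nonneg) simp
  have m: "(\<lambda>x. exp (\<theta> * (1 \<bullet> rvec x))) \<in> borel_measurable (count_space UNIV)"
    by simp
  have "integrable P (\<lambda>w. exp (\<theta> * (1 \<bullet> rvec (xi 0 0 i 0 w))))"
    by (rule Bochner_Integration.integrable_bound[OF int measurable_compose[OF measurable_xi m]])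
       (use X1 in eventually_elim, use th nn in \<open>simp add: rvec_add inner_add_right distrib_left\<close>)
  then show "integrable (measure_pmf (off i)) (\<lambda>x. exp (\<theta> * (1 \<bullet> rvec x)))"
    unfolding xi_law[of 0 0 i 0, symmetric] by (simp add: integrable_distr_eq measurable_xi)
  have "integrable P (\<lambda>w. exp (\<theta> * (1 \<bullet> rvec (I 1 w))))"
    by (rule Bochner_Integration.integrable_bound[OF int measurable_compose[OF measurable_I[OF order_refl] m]])
       (use X1 in eventually_elim, use th nn in \<open>simp add: rvec_add inner_add_right distrib_left\<close>)
  then show "integrable (measure_pmf imm) (\<lambda>x. exp (\<theta> * (1 \<bullet> rvec x)))"
    unfolding I_law[OF order_refl, symmetric] by (simp add: integrable_distr_eq measurable_I)
qed

text \<open>The Euclidean norm is at most the total population, which \<open>y \<le> exp y\<close>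
  dominates by the exponential moment.\<close>

lemma integrable_rvec:
  fixes p :: "(nat ^ 'n::finite) pmf"
  assumes th: "0 < \<theta>" and int: "integrable (measure_pmf p) (\<lambda>x. exp (\<theta> * (1 \<bullet> rvec x)))"
  shows "integrable (measure_pmf p) rvec"
proof (rule Bochner_Integration.integrable_bound[OF integrable_mult_left[OF int, of "1 / \<theta>"]])
  show "AE x in measure_pmf p. norm (rvec x) \<le> norm (exp (\<theta> * (1 \<bullet> rvec x)) * (1 / \<theta>))"
  proof (rule AE_I2)
    fix x :: "nat ^ 'n"
    have "norm (rvec x) \<le> (\<Sum>i\<in>UNIV. \<bar>rvec x $ i\<bar>)"
      by (rule norm_le_l1_cart)
    also have "\<dots> = 1 \<bullet> rvec x"
      by (simp add: inner_vec_def rvec_def)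
    finally have le: "norm (rvec x) \<le> 1 \<bullet> rvec x" .
    have "\<theta> * (1 \<bullet> rvec x) \<le> exp (\<theta> * (1 \<bullet> rvec x))"
      using exp_ge_add_one_self[of "\<theta> * (1 \<bullet> rvec x)"] by linarith
    then have "1 \<bullet> rvec x \<le> exp (\<theta> * (1 \<bullet> rvec x)) * (1 / \<theta>)"
      using th by (simp add: field_simps)
    with le show "norm (rvec x) \<le> norm (exp (\<theta> * (1 \<bullet> rvec x)) * (1 / \<theta>))"
      using th by simp
  qed
qed simp

text \<open>Since \<open>u $ j \<le> 1\<close>, the weighted population inherits the exponential
  moment of the total population.\<close>

lemma exp_inner_rvec_le_quadratic:
  fixes p :: "(nat ^ 'n::finite) pmf" and u :: "real ^ 'n"
  assumes th: "0 < \<theta>" and int: "integrable (measure_pmf p) (\<lambda>x. exp (\<theta> * (1 \<bullet> rvec x)))"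
    and u: "\<And>j. 0 \<le> u $ j" "\<And>j. u $ j \<le> 1"
  shows "\<exists>c\<ge>0. \<forall>a. \<bar>a\<bar> \<le> \<theta> / 2 \<longrightarrow>
    (\<integral>\<^sup>+x. ennreal (exp (a * (u \<bullet> rvec x))) \<partial>p)
      \<le> ennreal (exp (a * (u \<bullet> measure_pmf.expectation p rvec) + c * a\<^sup>2))"
proof -
  have "u \<bullet> rvec x \<le> 1 \<bullet> rvec x" for x
    unfolding inner_rvec using u by (intro sum_mono mult_right_mono) auto
  then have "integrable (measure_pmf p) (\<lambda>x. exp (\<theta> * (u \<bullet> rvec x)))"
    by (intro Bochner_Integration.integrable_bound[OF int]) (use th in auto)
  then have "\<exists>c\<ge>0. \<forall>a. \<bar>a\<bar> \<le> \<theta> / 2 \<longrightarrow>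
    (\<integral>\<^sup>+x. ennreal (exp (a * (u \<bullet> rvec x))) \<partial>p)
      \<le> ennreal (exp (a * measure_pmf.expectation p (\<lambda>x. u \<bullet> rvec x) + c * a\<^sup>2))"
    using u by (intro measure_pmf.exp_moment_le_quadratic th inner_rvec_nonneg) auto
  then show ?thesis
    using integrable_rvec[OF th int] by simp
qed

text \<open>Turns the eigenvector equation for \<open>u\<close> into the statement that a particle's
  mean weight is multiplied by \<rho>.\<close>

lemma inner_expectation_offspring:
  fixes off :: "'n::finite \<Rightarrow> (nat ^ 'n) pmf"
  assumes M: "is_mean_matrix off M" and int: "integrable (measure_pmf (off t)) rvec"
  shows "u \<bullet> measure_pmf.expectation (off t) rvec = (M *v u) $ t"
proof -
  have "M $ t $ j = measure_pmf.expectation (off t) rvec $ j" for j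
  proof -
    have "integrable (measure_pmf (off t)) (\<lambda>x. rvec x \<bullet> axis j 1)"
      using int by simp
    then have "M $ t $ j = measure_pmf.expectation (off t) (\<lambda>x. real (x $ j))"
      by (intro mean_matrix_eq_expectation M) (simp add: inner_axis rvec_def)
    also have "\<dots> = measure_pmf.expectation (off t) (\<lambda>x. rvec x \<bullet> axis j 1)"
      by (simp add: inner_axis rvec_def)
    also have "\<dots> = measure_pmf.expectation (off t) rvec \<bullet> axis j 1"
      by (rule integral_inner_left) (rule int)
    also have "\<dots> = measure_pmf.expectation (off t) rvec $ j"
      by (simp add: inner_axis)
    finally show ?thesis .
  qed
  then show ?thesis
    by (simp add: inner_vec_def matrix_vector_mult_def mult.commute)
qed

section \<open>The stated rate and the theorem\<close>

text \<open>With \<open>x = sqrt r ^ n * e\<close> the left side is \<open>x powr (2 / 3)\<close>,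
  which is at most 1 for \<open>x \<le> 1\<close> and at most \<open>x\<close> otherwise.\<close>

lemma powr_two_thirds_le:
  fixes e r :: real
  assumes "0 < e" "0 < r"
  shows "e powr (2 / 3) * (r powr (1 / 3)) ^ n \<le> 1 + sqrt r ^ n * e"
proof -
  define x where "x = sqrt r ^ n * e"
  have x: "0 < x"
    using assms by (simp add: x_def)
  have "sqrt r ^ n = r powr (n / 2)"
    using assms by (simp add: powr_half_sqrt[symmetric] powr_power)
  then have "x powr (2 / 3) = e powr (2 / 3) * (r powr (1 / 3)) ^ n"
    using assms by (simp add: x_def powr_mult powr_powr powr_power)
  moreover have "x powr (2 / 3) \<le> 1 + x"
  proof (cases "x \<le> 1")
    case True
    then have "x powr (2 / 3) \<le> 1"
      using powr_mono2[of "2 / 3" x 1] x by simp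
    then show ?thesis
      using x by simp
  next
    case False
    then have "x powr (2 / 3) \<le> x powr 1"
      by (intro powr_mono) auto
    then show ?thesis
      using x by simp
  qed
  ultimately show ?thesis
    by (simp add: x_def)
qed

theorem theorem1p5:
  fixes Pr :: "2 \<Rightarrow> 'w measure"
    and off :: "2 \<Rightarrow> (nat ^ 2) pmf"
    and imm :: "(nat ^ 2) pmf"
    and xi :: "nat \<Rightarrow> nat \<Rightarrow> 2 \<Rightarrow> nat \<Rightarrow> 'w \<Rightarrow> nat ^ 2"
    and I :: "nat \<Rightarrow> 'w \<Rightarrow> nat ^ 2"
    and Z0 :: "'w \<Rightarrow> nat ^ 2"
    and X :: "nat \<Rightarrow> 'w \<Rightarrow> nat ^ 2"
    and M :: "real ^ 2 ^ 2"
    and u v lam :: "real ^ 2"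
    and \<rho> \<theta>\<^sub>0 :: real
    and Y :: "'w \<Rightarrow> real"
  assumes process: "\<And>i. bpi_driver (Pr i) i off imm xi I Z0"
    and X_def: "X = bpi xi I Z0"
    and lam_def: "lam = measure_pmf.expectation imm rvec"
    and no_death: "offspring_gf off 0 = 0"
    and mean: "is_mean_matrix off M"
    and pos_reg: "positively_regular M"
    and max_ev: "is_max_eigenvalue M \<rho>"
    and supercritical: "\<rho> > 1"
    and right_ev: "M *v u = \<rho> *s u" "\<And>j. u $ j > 0"
    and left_ev: "v v* M = \<rho> *s v" "\<And>j. v $ j > 0"
    and normalized: "v \<bullet> u = 1" "u \<bullet> 1 = 1"
    and Y_measurable: "\<And>i. Y \<in> borel_measurable (Pr i)"
    and Y_limit: "\<And>i. AE \<omega> in Pr i. (\<lambda>n. Y_seq \<rho> u lam X n \<omega>) \<longlonglongrightarrow> Y \<omega>"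
    and exp_moment: "\<theta>\<^sub>0 > 0"
      "\<And>i. integrable (Pr i) (\<lambda>\<omega>. exp (\<theta>\<^sub>0 * (1 \<bullet> rvec (X 1 \<omega>))))"
  shows "\<exists>C\<^sub>4 \<kappa>\<^sub>1. 0 < C\<^sub>4 \<and> 0 < \<kappa>\<^sub>1 \<and>
    (\<forall>\<epsilon>>0. \<forall>i. \<forall>n\<ge>1.
       measure (Pr i) {\<omega> \<in> space (Pr i). \<bar>Y_seq \<rho> u lam X n \<omega> - Y \<omega>\<bar> > \<epsilon>}
         \<le> C\<^sub>4 * exp (- \<kappa>\<^sub>1 * \<epsilon> powr (2 / 3) * (\<rho> powr (1 / 3)) ^ n))"
proof -
  have u0: "0 \<le> u $ j" for j
    using right_ev(2)[of j] by simp
  have u1: "u $ j \<le> 1" for j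
  proof -
    have "u $ j \<le> (\<Sum>t\<in>UNIV. u $ t)"
      by (intro member_le_sum u0) auto
    then show ?thesis
      using normalized(2) by (simp add: inner_vec_def)
  qed
  \<comment> \<open>Varying the starting type gives the moment for every offspring law.\<close>
  have int_off: "integrable (measure_pmf (off t)) (\<lambda>x. exp (\<theta>\<^sub>0 * (1 \<bullet> rvec x)))" for t
    using exp_moment(2)[of t] unfolding X_def
    by (rule bpi_driver.integrable_exp_laws(1)[OF process exp_moment(1)])
  have int_imm: "integrable (measure_pmf imm) (\<lambda>x. exp (\<theta>\<^sub>0 * (1 \<bullet> rvec x)))"
    using exp_moment(2) unfolding X_def
    by (rule bpi_driver.integrable_exp_laws(2)[OF process exp_moment(1)])
  have mean_off: "u \<bullet> measure_pmf.expectation (off t) rvec = \<rho> * u $ t" for t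
    using inner_expectation_offspring[OF mean integrable_rvec[OF exp_moment(1) int_off]] right_ev(1) by simp
  obtain cI where cI: "0 \<le> cI" "\<And>a. \<bar>a\<bar> \<le> \<theta>\<^sub>0 / 2 \<Longrightarrow>
      (\<integral>\<^sup>+x. ennreal (exp (a * (u \<bullet> rvec x))) \<partial>imm) \<le> ennreal (exp (a * (u \<bullet> lam) + cI * a\<^sup>2))"
    using exp_inner_rvec_le_quadratic[OF exp_moment(1) int_imm u0 u1] unfolding lam_def by blast
  have "\<forall>t. \<exists>c\<ge>0. \<forall>a. \<bar>a\<bar> \<le> \<theta>\<^sub>0 / 2 \<longrightarrow>
      (\<integral>\<^sup>+x. ennreal (exp (a * (u \<bullet> rvec x))) \<partial>off t) \<le> ennreal (exp (a * (\<rho> * u $ t) + c * a\<^sup>2))"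
    using exp_inner_rvec_le_quadratic[OF exp_moment(1) int_off u0 u1] unfolding mean_off by blast
  then obtain cO where cO: "\<And>t. 0 \<le> cO t" "\<And>t a. \<bar>a\<bar> \<le> \<theta>\<^sub>0 / 2 \<Longrightarrow>
      (\<integral>\<^sup>+x. ennreal (exp (a * (u \<bullet> rvec x))) \<partial>off t) \<le> ennreal (exp (a * (\<rho> * u $ t) + cO t * a\<^sup>2))"
    by metis
  \<comment> \<open>Dividing by \<open>u $ t\<close> makes the quadratic error of a particle
    proportional to its weight; the summand 1 makes \<open>c\<close> positive.\<close>
  define c where "c = cI + (\<Sum>t\<in>UNIV. cO t / u $ t) + 1"
  have q0: "0 \<le> cO t / u $ t" for t
    using cO(1) u0 by simp
  then have qs: "0 \<le> (\<Sum>t\<in>UNIV. cO t / u $ t)"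
    by (intro sum_nonneg) auto
  have c: "0 < c" "cI \<le> c"
    using cI(1) qs by (auto simp: c_def)
  have cOc: "cO t \<le> c * u $ t" for t
  proof -
    have "cO t / u $ t \<le> (\<Sum>t\<in>UNIV. cO t / u $ t)"
      by (rule member_le_sum) (use q0 in auto)
    then have "cO t / u $ t \<le> c"
      using cI(1) by (simp add: c_def)
    then show ?thesis
      using right_ev(2)[of t] by (simp add: field_simps)
  qed
  have drift: "0 \<le> u \<bullet> lam"
  proof -
    have "u \<bullet> lam = measure_pmf.expectation imm (\<lambda>x. u \<bullet> rvec x)"
      using integrable_rvec[OF exp_moment(1) int_imm] by (simp add: lam_def)
    also have "0 \<le> \<dots>"
      by (simp add: inner_rvec_nonneg u0)
    finally show ?thesis .
  qed
  define \<beta> where "\<beta> = 4 * c / (\<rho> * (\<rho> - 1))"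
  define \<gamma> where "\<gamma> = \<beta> * (u \<bullet> lam) + 4 * c"
  \<comment> \<open>Small enough for both smallness conditions of the iteration, with
    \<open>\<theta>\<^sub>0 / 2\<close> in the role of \<delta>.\<close>
  define \<eta> where "\<eta> = min (\<theta>\<^sub>0 / 4) (1 / \<beta>)"
  have beta: "0 < \<beta>"
    using c supercritical by (simp add: \<beta>_def)
  have eta: "0 < \<eta>" "2 * \<eta> \<le> \<theta>\<^sub>0 / 2" "\<beta> * \<eta> \<le> 1"
  proof -
    show "0 < \<eta>" "2 * \<eta> \<le> \<theta>\<^sub>0 / 2"
      using beta exp_moment(1) by (auto simp: \<eta>_def)
    have "\<beta> * \<eta> \<le> \<beta> * (1 / \<beta>)"
      using beta by (intro mult_left_mono) (auto simp: \<eta>_def)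
    then show "\<beta> * \<eta> \<le> 1"
      using beta by simp
  qed
  have quad: "bpi_quadratic (Pr i) i off imm xi I Z0 u lam \<rho> c (\<theta>\<^sub>0 / 2) \<beta> \<gamma> \<eta>" for i
  proof (intro bpi_quadratic.intro process bpi_quadratic_axioms.intro)
    fix a t assume a: "\<bar>a\<bar> \<le> \<theta>\<^sub>0 / 2"
    have "a * (\<rho> * u $ t) + cO t * a\<^sup>2 \<le> (\<rho> * a + c * a\<^sup>2) * u $ t"
      using mult_right_mono[OF cOc[of t], of "a\<^sup>2"] by (simp add: algebra_simps)
    then show "(\<integral>\<^sup>+x. ennreal (exp (a * (u \<bullet> rvec x))) \<partial>off t) \<le> ennreal (exp ((\<rho> * a + c * a\<^sup>2) * u $ t))"
      by (intro order_trans[OF cO(2)[OF a]] ennreal_leI) simp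
  next
    fix a assume a: "\<bar>a\<bar> \<le> \<theta>\<^sub>0 / 2"
    show "(\<integral>\<^sup>+x. ennreal (exp (a * (u \<bullet> rvec x))) \<partial>imm) \<le> ennreal (exp (a * (u \<bullet> lam) + c * a\<^sup>2))"
      by (intro order_trans[OF cI(2)[OF a]] ennreal_leI) (simp add: c mult_right_mono)
  qed (use u0 u1 supercritical c drift eta \<beta>_def \<gamma>_def in auto)
  \<comment> \<open>\<open>K\<close> depends only on constants common to all starting types, so one
    \<open>C\<close> serves every \<open>i\<close>.\<close>
  define C where "C = 2 * exp (bpi_quadratic.K u lam \<rho> \<beta> \<gamma> \<eta>)"
  show ?thesis
  \<comment> \<open>The factor \<open>exp \<eta>\<close> pays for the summand 1 in
    \<open>x powr (2 / 3) \<le> 1 + x\<close>.\<close>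
  proof (rule exI[of _ "C * exp \<eta>"], rule exI[of _ \<eta>], intro conjI allI impI)
    fix \<epsilon> :: real and i n assume eps: "0 < \<epsilon>"
    have "measure (Pr i) {\<omega> \<in> space (Pr i). \<bar>Y_seq \<rho> u lam X n \<omega> - Y \<omega>\<bar> > \<epsilon>}
        \<le> C * exp (- (\<eta> * sqrt \<rho> ^ n * \<epsilon>))"
      unfolding C_def X_def
      by (rule bpi_quadratic.prob_bpi_Y_diff_le[OF quad Y_measurable Y_limit[unfolded X_def]])
    also have "C * exp (- (\<eta> * sqrt \<rho> ^ n * \<epsilon>))
        \<le> C * exp (\<eta> + - \<eta> * \<epsilon> powr (2 / 3) * (\<rho> powr (1 / 3)) ^ n)"
    proof -
      have "\<eta> * (\<epsilon> powr (2 / 3) * (\<rho> powr (1 / 3)) ^ n) \<le> \<eta> * (1 + sqrt \<rho> ^ n * \<epsilon>)"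
        using eta eps supercritical by (intro mult_left_mono powr_two_thirds_le) auto
      then show ?thesis
        by (intro mult_left_mono) (auto simp: C_def algebra_simps)
    qed
    also have "\<dots> = C * exp \<eta> * exp (- \<eta> * \<epsilon> powr (2 / 3) * (\<rho> powr (1 / 3)) ^ n)"
      by (simp only: exp_add mult.assoc)
    finally show "measure (Pr i) {\<omega> \<in> space (Pr i). \<bar>Y_seq \<rho> u lam X n \<omega> - Y \<omega>\<bar> > \<epsilon>}
        \<le> C * exp \<eta> * exp (- \<eta> * \<epsilon> powr (2 / 3) * (\<rho> powr (1 / 3)) ^ n)" .
  qed (auto simp: C_def eta)
qed

end
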